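(* Let $\Omega\subset\mathbb{R}^2$ be a simply connected polygonal domain with a triangulation $\mathcal{T}_h$ of $\overline{\Omega}$ into uniform squares of side $h$, satisfying the standing mesh assumption stated in the context. Then the dimension of $$V_h=\{\mathbf{v}_h\in[\mathcal{NC}^h_0(\Omega)]^2\ :\ \mathrm{div}_h\,\mathbf{v}_h=0\}$$ is the number of interior squares in $\mathcal{T}_h$.
   Context: Mesh: $\mathcal{T}_h$ is a (finite) triangulation of $\overline{\Omega}$ into uniform squares of width and height $h$ (sides parallel to the coordinate axes). A vertex or edge of $\mathcal{T}_h$ is a boundary vertex or edge if it belongs to $\partial\Omega$; otherwise it is an interior vertex or edge. A square of $\mathcal{T}_h$ is an interior square if all its 4 vertices are interior vertices; otherwise it is a boundary square. Standing mesh assumption: no square has 4 boundary vertices; no interior edge meets 2 boundary vertices; if a square has only two boundary vertices, they are the two endpoints of one edge. $P_1$-nonconforming spaces: $\mathcal{NC}^h(\Omega)$ is the set of $v_h\in L^2(\Omega)$ such that $v_h|_Q\in\mathrm{span}\{1,x,y\}$ for every square $Q\in\mathcal{T}_h$ and $v_h$ is continuous at every midpoint of the edges of $\mathcal{T}_h$. $\mathcal{NC}^h_0(\Omega)$ is the subspace of those $v_h\in\mathcal{NC}^h(\Omega)$ with $v_h(m)=0$ for all midpoints $m$ of boundary edges. Discrete divergence: $(\mathrm{div}_h\mathbf{v})|_Q=\mathrm{div}(\mathbf{v}|_Q)$ for all $Q\in\mathcal{T}_h$. *)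

theory Defs
  imports "HOL-Analysis.Analysis" "HOL-Library.Function_Algebras"
begin

text \<open>
  The real vector space structure on functions (pointwise), so that \<^const>\<open>span\<close>,
  \<^const>\<open>subspace\<close> and \<^const>\<open>dim\<close> apply to spaces of functions; addition and zero are
  those of \<^theory>\<open>HOL-Library.Function_Algebras\<close>.
\<close>

instantiation "fun" :: (type, real_vector) real_vector
begin

definition scaleR_fun :: "real \<Rightarrow> ('a \<Rightarrow> 'b) \<Rightarrow> 'a \<Rightarrow> 'b" where
  "scaleR_fun c f = (\<lambda>x. c *\<^sub>R f x)"

instance
  by standard (simp_all add: scaleR_fun_def plus_fun_def scaleR_add_right scaleR_add_left)

end

type_synonym point = "real \<times> real"

text \<open>
  A polygonal domain is a bounded domain whose boundary consists of finitely many segments.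
  The condition \<open>interior (closure \<Omega>) = \<Omega>\<close> says that \<open>\<Omega>\<close> has no slits or removed
  points, which a triangulation of \<open>closure \<Omega>\<close> could not see.
\<close>

definition polygonal_domain :: "point set \<Rightarrow> bool" where
  "polygonal_domain \<Omega> \<longleftrightarrow>
     \<Omega> \<noteq> {} \<and> open \<Omega> \<and> connected \<Omega> \<and> bounded \<Omega> \<and> interior (closure \<Omega>) = \<Omega> \<and>
     (\<exists>S. finite S \<and> (\<forall>s\<in>S. \<exists>a b. s = closed_segment a b) \<and> frontier \<Omega> = \<Union>S)"


text \<open>The elements of a mesh are closed squares. As for \<^const>\<open>simplicial_complex\<close>, two of them
  meet in a common face, i.e. in the empty set, a vertex or a whole edge of both.\<close>

definition uniform_square_mesh :: "real \<Rightarrow> point set \<Rightarrow> point set set \<Rightarrow> bool" where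
  "uniform_square_mesh h \<Omega> T \<longleftrightarrow>
     h > 0 \<and> finite T \<and> (\<forall>Q\<in>T. \<exists>a. Q = cbox a (a + (h, h))) \<and> \<Union>T = closure \<Omega> \<and>
     (\<forall>Q\<in>T. \<forall>Q'\<in>T. Q \<inter> Q' face_of Q \<and> Q \<inter> Q' face_of Q')"

definition square_vertices :: "point set \<Rightarrow> point set" where
  "square_vertices Q = {p. p extreme_point_of Q}"

definition mesh_vertices :: "point set set \<Rightarrow> point set" where
  "mesh_vertices T = (\<Union>Q\<in>T. square_vertices Q)"

definition mesh_edges :: "point set set \<Rightarrow> point set set" where
  "mesh_edges T = {e. \<exists>Q\<in>T. e edge_of Q}"

definition boundary_vertices :: "point set \<Rightarrow> point set set \<Rightarrow> point set" where
  "boundary_vertices \<Omega> T = {p \<in> mesh_vertices T. p \<in> frontier \<Omega>}"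

definition boundary_edges :: "point set \<Rightarrow> point set set \<Rightarrow> point set set" where
  "boundary_edges \<Omega> T = {e \<in> mesh_edges T. e \<subseteq> frontier \<Omega>}"

definition interior_vertices :: "point set \<Rightarrow> point set set \<Rightarrow> point set" where
  "interior_vertices \<Omega> T = mesh_vertices T - boundary_vertices \<Omega> T"

definition interior_edges :: "point set \<Rightarrow> point set set \<Rightarrow> point set set" where
  "interior_edges \<Omega> T = mesh_edges T - boundary_edges \<Omega> T"

definition interior_squares :: "point set \<Rightarrow> point set set \<Rightarrow> point set set" where
  "interior_squares \<Omega> T = {Q \<in> T. square_vertices Q \<subseteq> interior_vertices \<Omega> T}"

definition standing_mesh_assumption :: "point set \<Rightarrow> point set set \<Rightarrow> bool" where
  "standing_mesh_assumption \<Omega> T \<longleftrightarrow>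
     (\<forall>Q\<in>T. \<not> square_vertices Q \<subseteq> boundary_vertices \<Omega> T) \<and>
     (\<forall>e\<in>interior_edges \<Omega> T.
        \<not> (\<exists>p\<in>boundary_vertices \<Omega> T. \<exists>q\<in>boundary_vertices \<Omega> T. p \<noteq> q \<and> p \<in> e \<and> q \<in> e)) \<and>
     (\<forall>Q\<in>T. card (square_vertices Q \<inter> boundary_vertices \<Omega> T) = 2 \<longrightarrow>
        (\<exists>p q. square_vertices Q \<inter> boundary_vertices \<Omega> T = {p, q} \<and>
               closed_segment p q \<in> mesh_edges T))"


definition midpoint_of_edge :: "point \<Rightarrow> point set \<Rightarrow> bool" where
  "midpoint_of_edge m e \<longleftrightarrow> (\<exists>a b. e = closed_segment a b \<and> m = midpoint a b)"

text \<open>The union of the open squares: the points off the mesh skeleton.\<close>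

definition cells :: "point set set \<Rightarrow> point set" where
  "cells T = (\<Union>Q\<in>T. interior Q)"

definition square_integrable :: "point set \<Rightarrow> (point \<Rightarrow> real) \<Rightarrow> bool" where
  "square_integrable \<Omega> v \<longleftrightarrow>
     v \<in> borel_measurable (lebesgue_on \<Omega>) \<and> integrable (lebesgue_on \<Omega>) (\<lambda>p. (v p)\<^sup>2)"

definition P1 :: "(point \<Rightarrow> real) set" where
  "P1 = span {\<lambda>p. 1, \<lambda>p. fst p, \<lambda>p. snd p}"

text \<open>
  An element of \<open>L\<^sup>2(\<Omega>)\<close> is a class of functions up to null sets. A class that is given by
  an element of \<^const>\<open>P1\<close> on each square has exactly one representative that coincides with
  these affine functions on the open squares and vanishes at all other points, and the
  nonconforming space is the space of these representatives. As the values on the skeleton carry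
  no information, continuity at an edge midpoint \<open>m\<close>, and the value there, refer to the limit at
  \<open>m\<close> from within the open squares.
\<close>

definition NC :: "point set \<Rightarrow> point set set \<Rightarrow> (point \<Rightarrow> real) set" where
  "NC \<Omega> T = {v. square_integrable \<Omega> v \<and>
     (\<forall>p. p \<notin> cells T \<longrightarrow> v p = 0) \<and>
     (\<forall>Q\<in>T. \<exists>g\<in>P1. \<forall>p\<in>interior Q. v p = g p) \<and>
     (\<forall>e\<in>mesh_edges T. \<forall>m. midpoint_of_edge m e \<longrightarrow> (\<exists>l. (v \<longlongrightarrow> l) (at m within cells T)))}"

definition NC0 :: "point set \<Rightarrow> point set set \<Rightarrow> (point \<Rightarrow> real) set" where
  "NC0 \<Omega> T = {v \<in> NC \<Omega> T.
     \<forall>e\<in>boundary_edges \<Omega> T. \<forall>m. midpoint_of_edge m e \<longrightarrow> (v \<longlongrightarrow> 0) (at m within cells T)}"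

definition divergence :: "(point \<Rightarrow> point) \<Rightarrow> point \<Rightarrow> real" where
  "divergence v p =
     deriv (\<lambda>x. fst (v (x, snd p))) (fst p) + deriv (\<lambda>y. snd (v (fst p, y))) (snd p)"

text \<open>On the open squares, \<^const>\<open>divergence\<close> is the divergence of the restriction to the square.\<close>

definition div_h :: "point set set \<Rightarrow> (point \<Rightarrow> point) \<Rightarrow> point \<Rightarrow> real" where
  "div_h T v p = (if p \<in> cells T then divergence v p else 0)"

definition V_h :: "point set \<Rightarrow> point set set \<Rightarrow> (point \<Rightarrow> point) set" where
  "V_h \<Omega> T = {v. (\<lambda>p. fst (v p)) \<in> NC0 \<Omega> T \<and> (\<lambda>p. snd (v p)) \<in> NC0 \<Omega> T \<and>
     div_h T v = (\<lambda>p. 0)}"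

text \<open>As \<^const>\<open>dim\<close> is also \<open>0\<close> for infinite-dimensional spaces, finite dimension is required
  separately.\<close>

definition has_dimension :: "'a::real_vector set \<Rightarrow> nat \<Rightarrow> bool" where
  "has_dimension V n \<longleftrightarrow> subspace V \<and> (\<exists>B. finite B \<and> V \<subseteq> span B) \<and> dim V = n"

end

theory Submission
  imports Defs "HOL-Complex_Analysis.Riemann_Mapping"
begin

text \<open>
  The squares of the mesh lie on one lattice, so the mesh is a finite set \<open>S\<close> of index pairs and
  \<open>\<Omega>\<close> is the interior of the union of the squares in \<open>S\<close>. On this lattice the space of
  divergence-free fields is parametrised by discrete stream functions: an arbitrary function \<open>\<psi>\<close> on
  the interior squares has a discrete curl, which is a divergence-free nonconforming field with zero
  boundary values, and every such field arises from exactly one \<open>\<psi>\<close>.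

  This rests on two discrete Poincare lemmas. First, an affine function on a square is determined by
  its values at the edge midpoints, subject to the single relation that the two values on one
  pair of opposite edges have the same sum as those on the other pair. Up to the checkerboard sign
  \<open>(-1)^(i + j)\<close> of the vertices this relation says that the midpoint values form a
  closed 1-form on the edges, so that they are \<open>a(p) + a(q)\<close> on each edge \<open>pq\<close> for a function
  \<open>a\<close> of the vertices (\<open>vertex_potential\<close>). Secondly, let \<open>a\<close> and \<open>b\<close> be the vertex functions of the
  two components of a field, and let \<open>f = (a + b) / 2\<close> and \<open>g = (a - b) / 2\<close>. The divergence
  vanishes on a square iff the difference of \<open>f\<close> along one diagonal of it equals the difference of \<open>g\<close>
  along the other. A vertex connects two pairs of diagonally opposite squares, and so \<open>f\<close> and \<open>g\<close>
  form a 1-form on the graph of diagonal neighbours among the squares, which is again closed. Its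
  potential is the stream function \<open>\<psi>\<close> (\<open>stream_function_exists\<close>).

  Since all data can be extended by zero to the whole lattice, the potentials exist without any
  topological condition: they are sums that start to the left of the mesh. Topology decides where they
  vanish. Both potentials stay zero along every edge that does not have squares of the mesh on both
  sides, and the complement of a bounded simply connected open set in the plane is connected. Hence
  all lattice vertices outside \<open>\<Omega>\<close> are joined by such edges (\<open>exterior_vertices_connected\<close>), so
  \<open>a\<close> vanishes outside the interior vertices and \<open>\<psi>\<close> outside the interior squares. The curl is
  injective because a stream function in its kernel is constant along diagonals and vanishes far away.
\<close>

section \<open>The complement of a simply connected plane domain\<close>

text \<open>The corresponding fact about the complex plane is transported along the isometry
  \<open>(x, y) \<mapsto> x + iy\<close>.\<close>
lemma connected_complement_of_simply_connected:
  fixes \<Omega> :: "(real \<times> real) set"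
  assumes "open \<Omega>" "bounded \<Omega>" "simply_connected \<Omega>"
  shows "connected (- \<Omega>)"
proof -
  define f where "f = (\<lambda>p. Complex (fst p) (snd p))"
  define g where "g = (\<lambda>z. (Re z, Im z))"
  have fg: "f (g z) = z" and gf: "g (f p) = p" for z p
    by (simp_all add: f_def g_def)
  have cf: "continuous_on A f" for A
    unfolding f_def Complex_eq by (intro continuous_intros)
  have cg: "continuous_on A g" for A
    unfolding g_def by (intro continuous_intros)
  have eq: "f ` A = g -` A" for A
    by (auto simp: gf) (metis fg image_eqI)
  have "open (f ` \<Omega>)"
    unfolding eq using open_vimage[OF \<open>open \<Omega>\<close> cg] .
  moreover have "bounded (f ` \<Omega>)"
  proof -
    have "norm (f p) = norm p" for p
      by (simp add: f_def norm_prod_def complex_norm)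
    then show ?thesis
      using \<open>bounded \<Omega>\<close> by (auto simp: bounded_iff)
  qed
  moreover have "\<Omega> homeomorphic f ` \<Omega>"
    unfolding homeomorphic_def homeomorphism_def
    by (rule exI[of _ f], rule exI[of _ g]) (auto simp: fg gf cf cg image_iff)
  then have "simply_connected (f ` \<Omega>)"
    using \<open>simply_connected \<Omega>\<close> homeomorphic_simply_connected by blast
  ultimately have "connected (- (f ` \<Omega>))"
    using simply_connected_iff_simple by blast
  then have "connected (g ` (- (f ` \<Omega>)))"
    by (intro connected_continuous_image cg)
  moreover have "g ` (- (f ` \<Omega>)) = - \<Omega>"
    unfolding eq by (auto simp: image_iff) (metis ComplI gf vimageE)
  ultimately show ?thesis by simp
qed

section \<open>Primitives on the integer lattice\<close>

text \<open>
  The solution of \<open>x i j = w i j + c * x (i - 1) (j - d)\<close> that vanishes for \<open>i \<le> M\<close>, that is, the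
  sum of \<open>w\<close> (with signs if \<open>c = - 1\<close>) along a ray from the left. Rows (\<open>d = 0\<close>) give functions of the vertices,
  diagonals (\<open>d = 1\<close>) stream functions.
\<close>
function lattice_potential :: "real \<Rightarrow> int \<Rightarrow> int \<Rightarrow> (int \<Rightarrow> int \<Rightarrow> real) \<Rightarrow> int \<Rightarrow> int \<Rightarrow> real" where
  "lattice_potential c d M w i j =
     (if i \<le> M then 0 else w i j + c * lattice_potential c d M w (i - 1) (j - d))"
  by auto
termination by (relation "Wellfounded.measure (\<lambda>(c, d, M, w, i, j). nat (i - M))") auto
declare lattice_potential.simps [simp del]

lemma lattice_potential_left: "i \<le> M \<Longrightarrow> lattice_potential c d M w i j = 0"
  by (simp add: lattice_potential.simps)

lemma lattice_potential_step:
  assumes "\<And>i j. i \<le> M \<Longrightarrow> w i j = 0"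
  shows "lattice_potential c d M w i j = w i j + c * lattice_potential c d M w (i - 1) (j - d)"
  using assms by (cases "i \<le> M") (simp_all add: lattice_potential.simps[of c d M w i j] lattice_potential_left)

text \<open>This serves both for the uniqueness of potentials and for the defect in the second of the two
  equations of a potential, to which the closedness condition gives the recursion \<open>step\<close>.\<close>
lemma lattice_propagate_zero:
  fixes x :: "int \<Rightarrow> int \<Rightarrow> real"
  assumes left: "\<And>i j. i \<le> M \<Longrightarrow> x i j = 0"
    and step: "\<And>i j. x i j = c * x (i - 1) (j - d)"
  shows "x i j = 0"
proof -
  have "\<forall>j. x (M + int n) j = 0" for n
  proof (induction n)
    case 0
    then show ?case using left by simp
  next
    case (Suc n)
    show ?case
    proof
      fix j
      have "x (M + int (Suc n)) j = c * x (M + int n) (j - d)"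
        by (subst step) (simp add: algebra_simps)
      then show "x (M + int (Suc n)) j = 0" using Suc by simp
    qed
  qed
  from this[of "nat (i - M)"] show ?thesis
    using left[of i j] by (cases "i \<le> M") auto
qed

section \<open>Faces of squares\<close>

lemma face_of_interval_iff:
  fixes c d :: real
  assumes "c < d"
  shows "F face_of {c..d} \<longleftrightarrow> F = {} \<or> F = {c} \<or> F = {d} \<or> F = {c..d}"
proof
  assume F: "F face_of {c..d}"
  have sub: "F \<subseteq> {c..d}" and conv: "convex F"
    using F face_of_imp_subset face_of_imp_convex by auto
  have all: "F = {c..d}" if "x \<in> F" "c < x" "x < d" for x
  proof -
    have "x \<in> open_segment c d"
      using that by (simp add: open_segment_eq_real_ivl)
    then have "c \<in> F" "d \<in> F"
      using F that assms unfolding face_of_def by fastforce+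
    then have "closed_segment c d \<subseteq> F"
      using conv by (simp add: closed_segment_subset)
    then show ?thesis
      using sub assms by (auto simp: closed_segment_eq_real_ivl)
  qed
  show "F = {} \<or> F = {c} \<or> F = {d} \<or> F = {c..d}"
  proof (cases "c \<in> F \<and> d \<in> F")
    case True
    then have "closed_segment c d \<subseteq> F"
      using conv by (simp add: closed_segment_subset)
    then show ?thesis
      using sub assms by (auto simp: closed_segment_eq_real_ivl)
  next
    case False
    have "x = c \<or> x = d \<or> F = {c..d}" if "x \<in> F" for x
      using all[OF that] sub that by force
    then show ?thesis using False by blast
  qed
next
  assume *: "F = {} \<or> F = {c} \<or> F = {d} \<or> F = {c..d}"
  have "{c} face_of {c..d}" "{d} face_of {c..d}"
    using assms by (auto simp: face_of_singleton extreme_point_of_def open_segment_eq_real_ivl split: if_splits)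
  with * show "F face_of {c..d}"
    by (auto intro: face_of_refl)
qed

lemma box_eq_Times: "cbox (x, y) ((x, y) + (h, h)) = {x..x + h} \<times> {y..y + (h::real)}"
  by (simp add: cbox_Pair_eq)

lemma extreme_point_of_square:
  fixes h :: real
  assumes "h > 0"
  shows "p extreme_point_of cbox (x, y) ((x, y) + (h, h)) \<longleftrightarrow>
    p \<in> {(x, y), (x + h, y), (x, y + h), (x + h, y + h)}"
proof -
  obtain u v where p: "p = (u, v)" by force
  have "{(u, v)} face_of {x..x + h} \<times> {y..y + h} \<longleftrightarrow>
      {u} face_of {x..x + h} \<and> {v} face_of {y..y + h}"
    using face_of_Times_eq[of "{u}" "{v}"] by simp
  moreover have "{x..x + h} \<noteq> {u}" "{y..y + h} \<noteq> {v}"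
    using assms by (auto simp: atLeastAtMost_singleton_iff)
  ultimately show ?thesis
    unfolding face_of_singleton[symmetric] box_eq_Times p using assms
    by (auto simp: face_of_interval_iff)
qed

text \<open>A face of a rectangle is a product of faces of its sides; the dimension excludes all products but those of
  a side and an endpoint.\<close>
lemma edge_of_square:
  fixes h :: real
  assumes "h > 0"
  shows "e edge_of cbox (x, y) ((x, y) + (h, h)) \<longleftrightarrow>
    e \<in> {closed_segment (x, y) (x + h, y), closed_segment (x, y) (x, y + h),
         closed_segment (x, y + h) (x + h, y + h), closed_segment (x + h, y) (x + h, y + h)}"
    (is "?L = (e \<in> ?R)")
proof -
  have I: "x < x + h" "y < y + h" using assms by auto
  have hor: "closed_segment (s, t) (s + h, t) = {s..s + h} \<times> {t}"
   and ver: "closed_segment (s, t) (s, t + h) = {s} \<times> {t..t + h}" for s t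
    using assms by (auto simp: closed_segment_same_snd closed_segment_same_fst closed_segment_eq_real_ivl)
  have segdim: "aff_dim (closed_segment p q) = 1" if "p \<noteq> q" for p q :: point
    using that by (simp add: segment_convex_hull aff_dim_convex_hull)
  have sqdim: "aff_dim ({x..x + h} \<times> {y..y + h}) = 2"
  proof -
    have "interior ({x..x + h} \<times> {y..y + h}) \<noteq> {}"
      using assms by (simp add: interior_Times)
    from aff_dim_nonempty_interior[OF this] show ?thesis by simp
  qed
  show ?thesis
  proof
    assume ?L
    then have F: "e face_of {x..x + h} \<times> {y..y + h}" and d: "aff_dim e = 1"
      unfolding edge_of_def box_eq_Times by auto
    then obtain A B where e: "e = A \<times> B" and A: "A face_of {x..x + h}" and B: "B face_of {y..y + h}"
      unfolding face_of_Times_decomp by blast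
    have "A = {} \<or> A = {x} \<or> A = {x + h} \<or> A = {x..x + h}"
      "B = {} \<or> B = {y} \<or> B = {y + h} \<or> B = {y..y + h}"
      using A B I by (auto simp: face_of_interval_iff)
    then show "e \<in> ?R"
      unfolding hor ver using d sqdim by (auto simp: e)
  next
    assume e: "e \<in> ?R"
    then have "aff_dim e = 1"
      using assms by (auto simp: segdim)
    moreover have "e face_of {x..x + h} \<times> {y..y + h}"
      using e I unfolding hor ver by (auto simp: face_of_Times_eq face_of_interval_iff)
    ultimately show ?L
      unfolding edge_of_def box_eq_Times by auto
  qed
qed
lemma midpoint_of_edge_closed_segment: "midpoint_of_edge m (closed_segment a b) \<longleftrightarrow> m = midpoint a b"
  unfolding midpoint_of_edge_def closed_segment_eq doubleton_eq_iff by (metis midpoint_sym)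

section \<open>Edge-to-edge square meshes lie on a lattice\<close>

definition lattice_square :: "real \<Rightarrow> point \<Rightarrow> int \<Rightarrow> int \<Rightarrow> point set" where
  "lattice_square h z i j =
     cbox (z + (h * of_int i, h * of_int j)) (z + (h * of_int i, h * of_int j) + (h, h))"

lemma mem_lattice_square:
  "p \<in> lattice_square h z i j \<longleftrightarrow>
     fst z + h * of_int i \<le> fst p \<and> fst p \<le> fst z + h * of_int i + h \<and>
     snd z + h * of_int j \<le> snd p \<and> snd p \<le> snd z + h * of_int j + h"
  by (cases p; cases z) (auto simp: lattice_square_def cbox_Pair_eq)

lemma mem_interior_lattice_square:
  "p \<in> interior (lattice_square h z i j) \<longleftrightarrow>
     fst z + h * of_int i < fst p \<and> fst p < fst z + h * of_int i + h \<and>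
     snd z + h * of_int j < snd p \<and> snd p < snd z + h * of_int j + h"
  unfolding lattice_square_def interior_cbox
  by (cases p; cases z) (auto simp: mem_box Basis_prod_def)

text \<open>If two intervals of the same length overlapped in more than an endpoint without being equal, an
  endpoint of the intersection would lie in the interior of the first one,
  and the intersection would not be a face of it.\<close>
lemma interval_meets_in_face:
  fixes x y h :: real
  assumes "h > 0" "{x..x + h} \<inter> {y..y + h} face_of {x..x + h}" "{x..x + h} \<inter> {y..y + h} \<noteq> {}"
  shows "\<exists>k::int. y = x + h * k"
proof -
  have int: "{x..x + h} \<inter> {y..y + h} = {max x y..min x y + h}"
    by auto
  have "{max x y..min x y + h} = {x} \<or> {max x y..min x y + h} = {x + h} \<or>
      {max x y..min x y + h} = {x..x + h}"
    using assms(2,3) \<open>h > 0\<close> unfolding int by (simp add: face_of_interval_iff)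
  then have "y = x - h \<or> y = x + h \<or> y = x"
    unfolding atLeastAtMost_singleton_iff Icc_eq_Icc using \<open>h > 0\<close> by linarith
  then show ?thesis
  proof (elim disjE)
    assume "y = x - h" then show ?thesis by (intro exI[of _ "-1"]) simp
  next
    assume "y = x + h" then show ?thesis by (intro exI[of _ 1]) simp
  next
    assume "y = x" then show ?thesis by (intro exI[of _ 0]) simp
  qed
qed

lemma squares_meeting_in_face_aligned:
  fixes h :: real and a b :: point
  defines "Q \<equiv> cbox a (a + (h, h))" and "R \<equiv> cbox b (b + (h, h))"
  assumes "h > 0" "Q \<inter> R face_of Q" "Q \<inter> R \<noteq> {}"
  shows "\<exists>(k::int) (l::int). b = a + (h * k, h * l)"
proof -
  obtain x y u v where ab: "a = (x, y)" "b = (u, v)" by force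
  have int: "Q \<inter> R = ({x..x + h} \<inter> {u..u + h}) \<times> ({y..y + h} \<inter> {v..v + h})"
    unfolding Q_def R_def ab box_eq_Times by blast
  have Q: "Q = {x..x + h} \<times> {y..y + h}"
    unfolding Q_def ab box_eq_Times ..
  from assms(4) have "({x..x + h} \<inter> {u..u + h}) \<times> ({y..y + h} \<inter> {v..v + h})
      face_of {x..x + h} \<times> {y..y + h}"
    unfolding int unfolding Q .
  moreover have "{x..x + h} \<inter> {u..u + h} \<noteq> {}" "{y..y + h} \<inter> {v..v + h} \<noteq> {}"
    using assms(5) unfolding int by blast+
  ultimately show ?thesis
    using interval_meets_in_face[OF \<open>h > 0\<close>, of x u] interval_meets_in_face[OF \<open>h > 0\<close>, of y v]
    unfolding face_of_Times_eq ab by auto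
qed

lemma inj_lattice_square:
  assumes "h > 0"
  shows "inj (\<lambda>(i, j). lattice_square h z i j)"
proof (rule injI, clarify)
  fix i j k l
  assume eq: "lattice_square h z i j = lattice_square h z k l"
  show "i = k \<and> j = l"
  proof -
    have "z + (h * of_int i, h * of_int j) \<in> lattice_square h z i j"
      and "z + (h * of_int k, h * of_int l) \<in> lattice_square h z k l"
      using assms by (simp_all add: mem_lattice_square)
    then have "z + (h * of_int i, h * of_int j) \<in> lattice_square h z k l"
      and "z + (h * of_int k, h * of_int l) \<in> lattice_square h z i j"
      unfolding eq .
    then have "h * of_int i \<le> h * of_int k" "h * of_int k \<le> h * of_int i"
      "h * of_int j \<le> h * of_int l" "h * of_int l \<le> h * of_int j"
      unfolding mem_lattice_square by simp_all
    then show ?thesis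
      using assms by (auto simp: mult_le_cancel_left_pos)
  qed
qed

text \<open>
  The squares aligned with a given one and the remaining squares have disjoint closed unions, as
  squares that touch are aligned with each other. Since \<open>closure \<Omega>\<close> is connected, there are no
  remaining squares.
\<close>
lemma mesh_on_lattice:
  assumes mesh: "uniform_square_mesh h \<Omega> T" and "connected \<Omega>" "\<Omega> \<noteq> {}"
  shows "\<exists>z S. finite S \<and> T = (\<lambda>(i, j). lattice_square h z i j) ` S"
proof -
  have h: "h > 0" and finT: "finite T" and sq: "\<And>Q. Q \<in> T \<Longrightarrow> \<exists>a. Q = cbox a (a + (h, h))"
    and UnT: "\<Union>T = closure \<Omega>"
    and face: "\<And>Q R. Q \<in> T \<Longrightarrow> R \<in> T \<Longrightarrow> Q \<inter> R face_of Q"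
    using mesh unfolding uniform_square_mesh_def by auto
  have "T \<noteq> {}"
    using UnT \<open>\<Omega> \<noteq> {}\<close> closure_subset[of \<Omega>] by blast
  then obtain z where z: "cbox z (z + (h, h)) \<in> T"
    using sq by fast
  let ?L = "range (\<lambda>(i, j). lattice_square h z i j)"
  have cl: "closed (\<Union>U)" if "U \<subseteq> T" for U
  proof (rule closed_Union)
    show "finite U" using that finT by (rule finite_subset)
    show "\<forall>Q\<in>U. closed Q" using that sq closed_cbox by (metis subsetD)
  qed
  have "\<Union>(T \<inter> ?L) \<inter> \<Union>(T - ?L) = {}"
  proof (rule ccontr)
    assume "\<not> ?thesis"
    then obtain Q R where Q: "Q \<in> T" "Q \<in> ?L" and R: "R \<in> T" "R \<notin> ?L" and "Q \<inter> R \<noteq> {}"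
      by blast
    obtain i j where ij: "Q = lattice_square h z i j"
      using Q by auto
    obtain b where b: "R = cbox b (b + (h, h))"
      using sq R by blast
    obtain k l :: int where "b = z + (h * of_int i, h * of_int j) + (h * k, h * l)"
      using squares_meeting_in_face_aligned[OF h, of "z + (h * of_int i, h * of_int j)" b]
        face[OF Q(1) R(1)] \<open>Q \<inter> R \<noteq> {}\<close> unfolding ij b lattice_square_def by blast
    then have "R = lattice_square h z (i + k) (j + l)"
      unfolding b lattice_square_def by (cases z) (simp add: algebra_simps)
    with R show False by auto
  qed
  then have "\<Union>(T \<inter> ?L) \<inter> \<Union>(T - ?L) \<inter> \<Union>T = {}"
    by simp
  then have "\<Union>(T \<inter> ?L) \<inter> \<Union>T = {} \<or> \<Union>(T - ?L) \<inter> \<Union>T = {}"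
  proof (rule connected_closedD[rotated])
    show "connected (\<Union>T)"
      unfolding UnT using \<open>connected \<Omega>\<close> by (rule connected_imp_connected_closure)
    show "closed (\<Union>(T \<inter> ?L))" "closed (\<Union>(T - ?L))"
      by (auto intro: cl)
    show "\<Union>T \<subseteq> \<Union>(T \<inter> ?L) \<union> \<Union>(T - ?L)"
      by blast
  qed
  moreover have "z \<in> \<Union>(T \<inter> ?L) \<inter> \<Union>T"
  proof -
    have "cbox z (z + (h, h)) = lattice_square h z 0 0"
      by (cases z) (simp add: lattice_square_def)
    moreover have "z \<in> cbox z (z + (h, h))"
      using h by (cases z) (simp add: cbox_Pair_eq)
    moreover have "lattice_square h z 0 0 \<in> ?L"
      by (rule range_eqI[of _ _ "(0, 0)"]) simp
    ultimately show ?thesis using z by (metis IntI UnionI)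
  qed
  ultimately have "\<Union>(T - ?L) \<inter> \<Union>T = {}" by auto
  moreover have "Q \<noteq> {}" if "Q \<in> T" for Q
  proof -
    obtain a where "Q = cbox a (a + (h, h))" using sq[OF \<open>Q \<in> T\<close>] by blast
    then have "a \<in> Q" using h by (cases a) (simp add: cbox_Pair_eq)
    then show ?thesis by blast
  qed
  ultimately have "T \<subseteq> ?L" by blast
  then obtain S where S: "T = (\<lambda>(i, j). lattice_square h z i j) ` S"
    by (meson subset_imageE)
  then have "finite S"
    using finT inj_lattice_square[OF h] by (metis finite_imageD inj_on_subset subset_UNIV)
  with S show ?thesis by blast
qed

section \<open>Lattice coordinates and the exterior vertices\<close>

text \<open>One coordinate of the neighbourhood \<open>near\<close> below: the interval
  \<open>(\<lceil>x\<rceil> - 1, \<lfloor>x\<rfloor> + 1)\<close> around \<open>x\<close> meets only those closed unit intervals with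
  integer endpoints that contain \<open>x\<close>.\<close>
lemma interval_of_near_point:
  fixes x y :: real and i :: int
  assumes "of_int \<lceil>x\<rceil> - 1 < y" "y < of_int \<lfloor>x\<rfloor> + 1" "of_int i \<le> y" "y \<le> of_int i + 1"
  shows "of_int i \<le> x" "x \<le> of_int i + 1"
proof -
  have "i \<le> \<lfloor>x\<rfloor>" "\<lceil>x\<rceil> \<le> i + 1"
    using assms by linarith+
  then show "of_int i \<le> x" "x \<le> of_int i + 1"
    by linarith+
qed

lemma floor_of_near_point:
  fixes x y :: real and a :: int
  assumes "of_int \<lceil>x\<rceil> - 1 < y" "y < of_int \<lfloor>x\<rfloor> + 1" "of_int a \<le> y" "y \<le> of_int a + 1"
  shows "\<lfloor>x\<rfloor> = \<lfloor>y\<rfloor> \<or> \<lfloor>x\<rfloor> = \<lfloor>y\<rfloor> + 1 \<and> a = \<lfloor>y\<rfloor>"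
proof -
  have x: "of_int \<lfloor>y\<rfloor> \<le> x" "x \<le> of_int (\<lfloor>y\<rfloor> + 1)"
    using interval_of_near_point[OF assms(1,2), of "\<lfloor>y\<rfloor>"] by simp_all
  then have "\<lfloor>y\<rfloor> \<le> \<lfloor>x\<rfloor>" "\<lfloor>x\<rfloor> \<le> \<lfloor>y\<rfloor> + 1"
    by linarith+
  moreover have "a = \<lfloor>y\<rfloor>" if "\<lfloor>x\<rfloor> = \<lfloor>y\<rfloor> + 1"
  proof -
    have "x = of_int (\<lfloor>y\<rfloor> + 1)"
      using that x by linarith
    then have "of_int \<lfloor>y\<rfloor> < y"
      using assms(1) by simp
    then show ?thesis
      using assms(3,4) by linarith
  qed
  ultimately show ?thesis by linarith
qed

lemma P1_iff: "g \<in> P1 \<longleftrightarrow> (\<exists>\<alpha> \<beta> \<gamma>. g = (\<lambda>p. \<alpha> + \<beta> * fst p + \<gamma> * snd p))"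
proof
  assume "g \<in> P1"
  then show "\<exists>\<alpha> \<beta> \<gamma>. g = (\<lambda>p. \<alpha> + \<beta> * fst p + \<gamma> * snd p)"
    unfolding P1_def
  proof (induction rule: span_induct_alt)
    case base
    show ?case by (intro exI[of _ 0]) (simp add: fun_eq_iff)
  next
    case (step c f g)
    then obtain \<alpha> \<beta> \<gamma> where g: "g = (\<lambda>p. \<alpha> + \<beta> * fst p + \<gamma> * snd p)"
      by blast
    from step(1) consider "f = (\<lambda>p. 1)" | "f = fst" | "f = snd" by auto
    then show ?case
    proof cases
      case 1
      then show ?thesis
        by (intro exI[of _ "\<alpha> + c"] exI[of _ \<beta>] exI[of _ \<gamma>])
          (simp add: g fun_eq_iff scaleR_fun_def algebra_simps)
    next
      case 2
      then show ?thesis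
        by (intro exI[of _ \<alpha>] exI[of _ "\<beta> + c"] exI[of _ \<gamma>])
          (simp add: g fun_eq_iff scaleR_fun_def algebra_simps)
    next
      case 3
      then show ?thesis
        by (intro exI[of _ \<alpha>] exI[of _ \<beta>] exI[of _ "\<gamma> + c"])
          (simp add: g fun_eq_iff scaleR_fun_def algebra_simps)
    qed
  qed
next
  assume "\<exists>\<alpha> \<beta> \<gamma>. g = (\<lambda>p. \<alpha> + \<beta> * fst p + \<gamma> * snd p)"
  then obtain \<alpha> \<beta> \<gamma> where "g = (\<lambda>p. \<alpha> + \<beta> * fst p + \<gamma> * snd p)"
    by blast
  then have g: "g = \<alpha> *\<^sub>R (\<lambda>p. 1) + \<beta> *\<^sub>R (\<lambda>p. fst p) + \<gamma> *\<^sub>R (\<lambda>p. snd p)"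
    by (simp add: fun_eq_iff scaleR_fun_def)
  show "g \<in> P1"
    unfolding P1_def g by (intro span_add span_scale span_base) auto
qed

locale square_lattice =
  fixes h :: real and z :: point and S :: "(int \<times> int) set"
  assumes h_pos: "h > 0" and finite_S: "finite S"
begin

abbreviation "sq \<equiv> lattice_square h z"

definition pt :: "int \<Rightarrow> int \<Rightarrow> point" where
  "pt i j = z + (h * of_int i, h * of_int j)"

text \<open>Coordinates in which the lattice is the integer lattice.\<close>
definition X :: "point \<Rightarrow> real" where "X p = (fst p - fst z) / h"
definition Y :: "point \<Rightarrow> real" where "Y p = (snd p - snd z) / h"

definition mesh :: "point set set" where "mesh = (\<lambda>(i, j). sq i j) ` S"

definition domain :: "point set" where "domain = interior (\<Union>mesh)"

text \<open>All four squares around the vertex belong to the mesh, which is to say that it lies in the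
  domain (\<open>pt_mem_domain\<close>).\<close>
definition interior_vertex :: "int \<Rightarrow> int \<Rightarrow> bool" where
  "interior_vertex i j \<longleftrightarrow> (i, j) \<in> S \<and> (i - 1, j) \<in> S \<and> (i, j - 1) \<in> S \<and> (i - 1, j - 1) \<in> S"

lemma X_pt [simp]: "X (pt i j) = of_int i" and Y_pt [simp]: "Y (pt i j) = of_int j"
  using h_pos by (simp_all add: X_def Y_def pt_def)

lemma mem_sq: "p \<in> sq i j \<longleftrightarrow> of_int i \<le> X p \<and> X p \<le> of_int i + 1 \<and> of_int j \<le> Y p \<and> Y p \<le> of_int j + 1"
  using h_pos by (auto simp: mem_lattice_square X_def Y_def field_simps)

lemma mem_interior_sq:
  "p \<in> interior (sq i j) \<longleftrightarrow> of_int i < X p \<and> X p < of_int i + 1 \<and> of_int j < Y p \<and> Y p < of_int j + 1"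
  using h_pos by (auto simp: mem_interior_lattice_square X_def Y_def field_simps)

lemma continuous_X [continuous_intros]: "continuous_on A X"
  and continuous_Y [continuous_intros]: "continuous_on A Y"
  unfolding X_def Y_def using h_pos by (auto intro!: continuous_intros)

lemma closed_sq: "closed (sq i j)"
  unfolding lattice_square_def by (rule closed_cbox)

lemma closure_interior_sq: "closure (interior (sq i j)) = sq i j"
  using h_pos unfolding lattice_square_def interior_cbox
  by (intro closure_box) (auto simp: box_ne_empty inner_simps Basis_prod_def)

lemma mem_floor_sq: "p \<in> sq \<lfloor>X p\<rfloor> \<lfloor>Y p\<rfloor>"
  by (simp add: mem_sq)

lemma interior_sq_unique:
  "p \<in> interior (sq i j) \<Longrightarrow> p \<in> sq k l \<longleftrightarrow> k = i \<and> l = j"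
  unfolding mem_sq mem_interior_sq by safe linarith+

text \<open>The open star of the point \<open>p\<close>: a neighbourhood that meets only the lattice squares
  containing \<open>p\<close>. It expresses local finiteness of the lattice.\<close>
definition near :: "point \<Rightarrow> point set" where
  "near p = {r. of_int \<lceil>X p\<rceil> - 1 < X r \<and> X r < of_int \<lfloor>X p\<rfloor> + 1 \<and>
                of_int \<lceil>Y p\<rceil> - 1 < Y r \<and> Y r < of_int \<lfloor>Y p\<rfloor> + 1}"

lemma open_near: "open (near p)" and mem_near: "p \<in> near p"
  unfolding near_def
   apply (intro open_Collect_conj open_Collect_less continuous_intros)
  by simp linarith

lemma near_sq: "r \<in> near p \<Longrightarrow> r \<in> sq i j \<Longrightarrow> p \<in> sq i j"
  using interval_of_near_point[of "X p" "X r" i] interval_of_near_point[of "Y p" "Y r" j]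
  unfolding near_def mem_sq by blast

lemma mem_domain: "p \<in> domain \<longleftrightarrow> (\<forall>i j. p \<in> sq i j \<longrightarrow> (i, j) \<in> S)"
proof
  assume p: "p \<in> domain"
  show "\<forall>i j. p \<in> sq i j \<longrightarrow> (i, j) \<in> S"
  proof (intro allI impI)
    fix i j assume "p \<in> sq i j"
    then have "p \<in> closure (interior (sq i j))"
      by (simp add: closure_interior_sq)
    then have "domain \<inter> interior (sq i j) \<noteq> {}"
      using p unfolding domain_def by (meson open_Int_closure_eq_empty open_interior disjoint_iff)
    then obtain r where r: "r \<in> interior (sq i j)" "r \<in> domain"
      by blast
    then obtain k l where "(k, l) \<in> S" "r \<in> sq k l"
      using interior_subset unfolding domain_def mesh_def by blast
    then show "(i, j) \<in> S"
      using interior_sq_unique[OF r(1), of k l] by simp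
  qed
next
  assume *: "\<forall>i j. p \<in> sq i j \<longrightarrow> (i, j) \<in> S"
  have "near p \<subseteq> \<Union>mesh"
  proof
    fix r assume "r \<in> near p"
    then have "(\<lfloor>X r\<rfloor>, \<lfloor>Y r\<rfloor>) \<in> S"
      using * near_sq mem_floor_sq by blast
    then show "r \<in> \<Union>mesh"
      unfolding mesh_def using mem_floor_sq[of r] by (intro UnionI[OF image_eqI[of _ _ "(\<lfloor>X r\<rfloor>, \<lfloor>Y r\<rfloor>)"]]) auto
  qed
  then show "p \<in> domain"
    unfolding domain_def using open_near mem_near by (meson interior_maximal subsetD)
qed

lemma sq_pt: "pt i j \<in> sq k l \<longleftrightarrow> (k = i \<or> k = i - 1) \<and> (l = j \<or> l = j - 1)"
  unfolding mem_sq by simp linarith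

lemma pt_mem_domain: "pt i j \<in> domain \<longleftrightarrow> interior_vertex i j"
  unfolding mem_domain sq_pt interior_vertex_def by auto

text \<open>
  A property of vertices that is invariant along the edges that are not interior holds at all
  exterior vertices as soon as it holds at one. Rounding down the coordinates of a point of the
  complement of the domain gives a vertex of the lattice face that contains the point, and the
  vertices of a face in the complement are joined by edges of that face, none of which is interior.
  So the truth value at the rounded point is locally constant on the complement, which is connected.
\<close>
theorem exterior_vertices_connected:
  fixes Z :: "int \<Rightarrow> int \<Rightarrow> bool"
  assumes conn: "connected (- domain)"
    and hor: "\<And>i j. \<not> ((i, j) \<in> S \<and> (i, j - 1) \<in> S) \<Longrightarrow> Z i j \<longleftrightarrow> Z (i + 1) j"
    and ver: "\<And>i j. \<not> ((i, j) \<in> S \<and> (i - 1, j) \<in> S) \<Longrightarrow> Z i j \<longleftrightarrow> Z i (j + 1)"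
    and start: "\<not> interior_vertex k l" "Z k l"
    and ij: "\<not> interior_vertex i j"
  shows "Z i j"
proof -
  define f where "f p = Z \<lfloor>X p\<rfloor> \<lfloor>Y p\<rfloor>" for p
  \<comment> \<open>The face containing \<open>r\<close> has the face containing \<open>p\<close> in its closure, so both rounded points are
    vertices of it. A square \<open>(a, b)\<close> that is missing from the mesh and contains \<open>r\<close> shows that the
    connecting edges are not interior.\<close>
  have "f r = f p" if r: "r \<in> near p" "r \<notin> domain" for p r
  proof -
    define m n where mn: "m = \<lfloor>X r\<rfloor>" "n = \<lfloor>Y r\<rfloor>"
    obtain a b where ab: "r \<in> sq a b" "(a, b) \<notin> S"
      using r(2) mem_domain by blast
    have x: "\<lfloor>X p\<rfloor> = m \<or> \<lfloor>X p\<rfloor> = m + 1 \<and> a = m"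
      using r(1) ab(1) floor_of_near_point[of "X p" "X r" a] unfolding near_def mem_sq mn by blast
    have y: "\<lfloor>Y p\<rfloor> = n \<or> \<lfloor>Y p\<rfloor> = n + 1 \<and> b = n"
      using r(1) ab(1) floor_of_near_point[of "Y p" "Y r" b] unfolding near_def mem_sq mn by blast
    have a: "a = m \<or> a = m - 1" and b: "b = n \<or> b = n - 1"
      using ab(1) unfolding mem_sq mn by linarith+
    have "Z \<lfloor>X p\<rfloor> \<lfloor>Y p\<rfloor> = Z m n"
      using x y
    proof (elim disjE conjE, goal_cases)
      case 1 then show ?case by simp
    next
      case 2 then show ?case using ver[of m n] a ab(2) by auto
    next
      case 3 then show ?case using hor[of m n] b ab(2) by auto
    next
      case 4 then show ?case using hor[of m n] ver[of "m + 1" n] ab(2) by auto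
    qed
    then show ?thesis unfolding f_def mn by simp
  qed
  then have "f constant_on - domain"
    by (intro locally_constant_imp_constant[OF conn])
      (metis (no_types, lifting) openin_open_Int open_near mem_near Int_iff ComplD)
  moreover have "pt i j \<in> - domain" "pt k l \<in> - domain"
    using start ij by (simp_all add: pt_mem_domain)
  ultimately have "f (pt i j) = f (pt k l)"
    unfolding constant_on_def by metis
  with start show ?thesis
    by (simp add: f_def)
qed

section \<open>Discrete potentials\<close>

lemma left_of_mesh:
  obtains M where "\<And>i j. (i, j) \<in> S \<Longrightarrow> M < i"
proof
  fix i j assume "(i, j) \<in> S"
  then have "i \<in> fst ` S" by force
  \<comment> \<open>The element \<open>0\<close> is inserted to cover the empty mesh.\<close>
  then have "Min (insert 0 (fst ` S)) \<le> i"
    using finite_S by (intro Min_le) auto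
  then show "Min (insert 0 (fst ` S)) - 1 < i" by simp
qed

text \<open>
  \<open>H i j\<close> and \<open>V i j\<close> are prescribed on the horizontal and the vertical edge that start at the vertex
  \<open>(i, j)\<close>. The potential is obtained from \<open>H\<close> by alternating sums along rows; the condition
  on opposite edges makes it match \<open>V\<close> as well. Where the prescribed values vanish, a zero at one end
  of an edge forces a zero at the other.
\<close>
theorem vertex_potential:
  fixes H V :: "int \<Rightarrow> int \<Rightarrow> real"
  assumes conn: "connected (- domain)"
    and H0: "\<And>i j. \<not> ((i, j) \<in> S \<and> (i, j - 1) \<in> S) \<Longrightarrow> H i j = 0"
    and V0: "\<And>i j. \<not> ((i, j) \<in> S \<and> (i - 1, j) \<in> S) \<Longrightarrow> V i j = 0"
    and closed: "\<And>i j. V i j + V (i + 1) j = H i j + H i (j + 1)"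
  shows "\<exists>a. (\<forall>i j. \<not> interior_vertex i j \<longrightarrow> a i j = 0) \<and>
    (\<forall>i j. a i j + a (i + 1) j = H i j) \<and> (\<forall>i j. a i j + a i (j + 1) = V i j)"
proof -
  obtain M where M: "\<And>i j. (i, j) \<in> S \<Longrightarrow> M < i"
    using left_of_mesh by blast
  define a where "a = lattice_potential (-1) 0 M (\<lambda>i j. H (i - 1) j)"
  have a0: "a i j = 0" if "i \<le> M" for i j
    using that by (simp add: a_def lattice_potential_left)
  have "H (i - 1) j = 0" if "i \<le> M" for i j
    using that M by (intro H0) fastforce
  then have astep: "a i j = H (i - 1) j - a (i - 1) j" for i j
    unfolding a_def
    using lattice_potential_step[of M "\<lambda>i j. H (i - 1) j" "-1" 0 i j] by simp
  have aH: "a i j + a (i + 1) j = H i j" for i j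
    using astep[of "i + 1" j] by simp
  have aV: "a i j + a i (j + 1) = V i j" for i j
  proof -
    have "a i j + a i (j + 1) - V i j = 0"
    proof (rule lattice_propagate_zero[where c = "-1" and d = 0 and M = M])
      fix i j :: int assume "i \<le> M"
      then have "V i j = 0"
        using M by (intro V0) fastforce
      with a0[OF \<open>i \<le> M\<close>] show "a i j + a i (j + 1) - V i j = 0"
        by simp
    next
      fix i j :: int
      show "a i j + a i (j + 1) - V i j =
          - 1 * (a (i - 1) (j - 0) + a (i - 1) (j - 0 + 1) - V (i - 1) (j - 0))"
        using aH[of "i - 1" j] aH[of "i - 1" "j + 1"] closed[of "i - 1" j] by simp
    qed
    then show ?thesis by simp
  qed
  have "a i j = 0" if "\<not> interior_vertex i j" for i j
  proof (rule exterior_vertices_connected[OF conn _ _ _ _ that, where Z = "\<lambda>i j. a i j = 0"])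
    show "(a i j = 0) = (a (i + 1) j = 0)" if "\<not> ((i, j) \<in> S \<and> (i, j - 1) \<in> S)" for i j
      using aH[of i j] H0[OF that] by linarith
    show "(a i j = 0) = (a i (j + 1) = 0)" if "\<not> ((i, j) \<in> S \<and> (i - 1, j) \<in> S)" for i j
      using aV[of i j] V0[OF that] by linarith
    show "\<not> interior_vertex M 0"
      using M by (auto simp: interior_vertex_def)
    show "a M 0 = 0"
      by (simp add: a0)
  qed
  with aH aV show ?thesis by blast
qed

text \<open>A function on the squares, each indexed by its lower left vertex, is differentiated at a vertex
  across the four surrounding squares: north minus south in \<open>curl1\<close>, west minus east in \<open>curl2\<close>. So
  \<open>(curl1 \<psi>, curl2 \<psi>)\<close> is a discrete version of \<open>(\<partial>\<psi>/\<partial>y, - \<partial>\<psi>/\<partial>x)\<close>.\<close>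
definition curl1 :: "(int \<Rightarrow> int \<Rightarrow> real) \<Rightarrow> int \<Rightarrow> int \<Rightarrow> real" where
  "curl1 \<psi> i j = \<psi> i j + \<psi> (i - 1) j - \<psi> i (j - 1) - \<psi> (i - 1) (j - 1)"

definition curl2 :: "(int \<Rightarrow> int \<Rightarrow> real) \<Rightarrow> int \<Rightarrow> int \<Rightarrow> real" where
  "curl2 \<psi> i j = \<psi> (i - 1) j + \<psi> (i - 1) (j - 1) - \<psi> i j - \<psi> i (j - 1)"

text \<open>The divergence, multiplied by \<open>h\<close>, on a square of the nonconforming field with vertex functions
  \<open>a\<close> and \<open>b\<close> (see \<open>div_h_nc_fun\<close>).\<close>
definition lattice_div :: "(int \<Rightarrow> int \<Rightarrow> real) \<Rightarrow> (int \<Rightarrow> int \<Rightarrow> real) \<Rightarrow> int \<Rightarrow> int \<Rightarrow> real" where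
  "lattice_div a b i j = (a (i + 1) j + a (i + 1) (j + 1) - a i j - a i (j + 1))
     + (b i (j + 1) + b (i + 1) (j + 1) - b i j - b (i + 1) j)"

definition interior_square :: "int \<Rightarrow> int \<Rightarrow> bool" where
  "interior_square i j \<longleftrightarrow> interior_vertex i j \<and> interior_vertex (i + 1) j \<and>
     interior_vertex i (j + 1) \<and> interior_vertex (i + 1) (j + 1)"

definition stream_functions :: "(int \<Rightarrow> int \<Rightarrow> real) set" where
  "stream_functions = {\<psi>. \<forall>i j. \<not> interior_square i j \<longrightarrow> \<psi> i j = 0}"

definition vertex_functions :: "(int \<Rightarrow> int \<Rightarrow> real) set" where
  "vertex_functions = {a. \<forall>i j. \<not> interior_vertex i j \<longrightarrow> a i j = 0}"

lemma curl_vertex_functions: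
  assumes "\<psi> \<in> stream_functions"
  shows "curl1 \<psi> \<in> vertex_functions" "curl2 \<psi> \<in> vertex_functions"
  using assms unfolding vertex_functions_def stream_functions_def interior_square_def curl1_def curl2_def
  by auto

lemma div_curl: "lattice_div (curl1 \<psi>) (curl2 \<psi>) i j = 0"
  by (simp add: lattice_div_def curl1_def curl2_def)

text \<open>
  At a vertex, \<open>g = (a - b) / 2\<close> is the prescribed difference of \<open>\<psi>\<close> between the north-east and
  the south-west square, and \<open>f = (a + b) / 2\<close> that between north-west and south-east. Summing \<open>g\<close> along
  diagonals yields \<open>\<psi>\<close>, and zero divergence makes it match \<open>f\<close>. At an exterior vertex \<open>\<psi>\<close> agrees on
  diagonally opposite squares. An edge that is not interior has two squares in common with each of
  its ends, one from each diagonal pair, so if \<open>\<psi>\<close> vanishes on the four squares around one end, it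
  does so around the other.
\<close>
theorem stream_function_exists:
  assumes conn: "connected (- domain)"
    and a: "a \<in> vertex_functions" and b: "b \<in> vertex_functions"
    and div: "\<And>i j. lattice_div a b i j = 0"
  shows "\<exists>\<psi>\<in>stream_functions. a = curl1 \<psi> \<and> b = curl2 \<psi>"
proof -
  obtain M where M: "\<And>i j. (i, j) \<in> S \<Longrightarrow> M < i"
    using left_of_mesh by blast
  have ab0: "a i j = 0" "b i j = 0" if "\<not> interior_vertex i j" for i j
    using a b that by (auto simp: vertex_functions_def)
  have left: "\<not> interior_vertex i j" if "i \<le> M" for i j
    using M that by (fastforce simp: interior_vertex_def)
  define f where "f i j = (a i j + b i j) / 2" for i j
  define g where "g i j = (a i j - b i j) / 2" for i j
  define \<psi> where "\<psi> = lattice_potential 1 1 M g"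
  have \<psi>0: "\<psi> i j = 0" if "i \<le> M" for i j
    using that by (simp add: \<psi>_def lattice_potential_left)
  have \<psi>g: "\<psi> i j - \<psi> (i - 1) (j - 1) = g i j" for i j
    unfolding \<psi>_def using lattice_potential_step[of M g 1 1 i j] ab0 left
    by (simp add: g_def)
  have \<psi>f: "\<psi> (i - 1) j - \<psi> i (j - 1) = f i j" for i j
  proof -
    have "\<psi> (i - 1) j - \<psi> i (j - 1) - f i j = 0"
    proof (rule lattice_propagate_zero[where c = 1 and d = 1 and M = M])
      fix i j :: int assume "i \<le> M"
      then show "\<psi> (i - 1) j - \<psi> i (j - 1) - f i j = 0"
        using \<psi>0 ab0[OF left] by (simp add: f_def)
    next
      fix i j :: int
      have "g i (j - 1) - g (i - 1) j + f i j - f (i - 1) (j - 1) = 0"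
        using div[of "i - 1" "j - 1"] by (simp add: f_def g_def lattice_div_def field_simps)
      then show "\<psi> (i - 1) j - \<psi> i (j - 1) - f i j =
          1 * (\<psi> (i - 1 - 1) (j - 1) - \<psi> (i - 1) (j - 1 - 1) - f (i - 1) (j - 1))"
        using \<psi>g[of "i - 1" j] \<psi>g[of i "j - 1"] by simp
    qed
    then show ?thesis by simp
  qed
  have "a i j = curl1 \<psi> i j" "b i j = curl2 \<psi> i j" for i j
    using \<psi>g[of i j] \<psi>f[of i j] unfolding f_def g_def curl1_def curl2_def by (simp_all add: field_simps)
  then have eq: "a = curl1 \<psi>" "b = curl2 \<psi>"
    by (intro ext; blast)+
  \<comment> \<open>The invariant concerns all four squares around a vertex: \<open>\<psi>\<close> at the squares of one diagonal
    alone does not determine \<open>\<psi>\<close> at those of the other.\<close>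
  define Z where "Z i j \<longleftrightarrow> \<psi> i j = 0 \<and> \<psi> (i - 1) j = 0 \<and> \<psi> i (j - 1) = 0 \<and> \<psi> (i - 1) (j - 1) = 0" for i j
  have diag: "\<psi> i j = \<psi> (i - 1) (j - 1)" "\<psi> (i - 1) j = \<psi> i (j - 1)" if "\<not> interior_vertex i j" for i j
    using \<psi>g[of i j] \<psi>f[of i j] ab0[OF that] by (simp_all add: f_def g_def)
  have Z: "Z i j" if "\<not> interior_vertex i j" for i j
  proof (rule exterior_vertices_connected[OF conn _ _ _ _ that])
    fix i j assume "\<not> ((i, j) \<in> S \<and> (i, j - 1) \<in> S)"
    then have "\<not> interior_vertex i j" "\<not> interior_vertex (i + 1) j"
      by (auto simp: interior_vertex_def)
    from this[THEN diag(1)] this[THEN diag(2)] show "Z i j = Z (i + 1) j"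
      by (auto simp: Z_def)
  next
    fix i j assume "\<not> ((i, j) \<in> S \<and> (i - 1, j) \<in> S)"
    then have "\<not> interior_vertex i j" "\<not> interior_vertex i (j + 1)"
      by (auto simp: interior_vertex_def)
    from this[THEN diag(1)] this[THEN diag(2)] show "Z i j = Z i (j + 1)"
      by (auto simp: Z_def)
  next
    show "\<not> interior_vertex M 0" by (simp add: left)
    show "Z M 0" by (simp add: Z_def \<psi>0)
  qed
  have "\<psi> \<in> stream_functions"
    unfolding stream_functions_def interior_square_def
  proof (intro CollectI allI impI)
    fix i j
    assume "\<not> (interior_vertex i j \<and> interior_vertex (i + 1) j \<and>
      interior_vertex i (j + 1) \<and> interior_vertex (i + 1) (j + 1))"
    then have "Z i j \<or> Z (i + 1) j \<or> Z i (j + 1) \<or> Z (i + 1) (j + 1)"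
      using Z by blast
    then show "\<psi> i j = 0"
      by (auto simp: Z_def)
  qed
  with eq show ?thesis by blast
qed

lemma finite_interior_squares: "finite {(i, j). interior_square i j}"
  by (rule finite_subset[OF _ finite_S]) (auto simp: interior_square_def interior_vertex_def)

lemma curl_injective:
  assumes \<psi>: "\<psi> \<in> stream_functions" and "curl1 \<psi> = 0" "curl2 \<psi> = 0"
  shows "\<psi> = 0"
proof -
  obtain M where M: "\<And>i j. (i, j) \<in> S \<Longrightarrow> M < i"
    using left_of_mesh by blast
  have "\<psi> i j = 0" for i j
  proof (rule lattice_propagate_zero[where c = 1 and d = 1 and M = M])
    fix i j :: int assume "i \<le> M"
    then have "\<not> interior_square i j"
      using M by (fastforce simp: interior_square_def interior_vertex_def)
    with \<psi> show "\<psi> i j = 0"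
      by (simp add: stream_functions_def)
  next
    fix i j
    have "curl1 \<psi> i j = 0" "curl2 \<psi> i j = 0"
      using assms by simp_all
    then show "\<psi> i j = 1 * \<psi> (i - 1) (j - 1)"
      unfolding curl1_def curl2_def by linarith
  qed
  then show ?thesis by (intro ext) simp
qed

section \<open>Edges of the mesh\<close>

definition hmid :: "int \<Rightarrow> int \<Rightarrow> point" where "hmid i j = midpoint (pt i j) (pt (i + 1) j)"
definition vmid :: "int \<Rightarrow> int \<Rightarrow> point" where "vmid i j = midpoint (pt i j) (pt i (j + 1))"

definition hedge :: "int \<Rightarrow> int \<Rightarrow> point set" where "hedge i j = closed_segment (pt i j) (pt (i + 1) j)"
definition vedge :: "int \<Rightarrow> int \<Rightarrow> point set" where "vedge i j = closed_segment (pt i j) (pt i (j + 1))"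

lemma X_hmid [simp]: "X (hmid i j) = of_int i + 1/2" and Y_hmid [simp]: "Y (hmid i j) = of_int j"
  and X_vmid [simp]: "X (vmid i j) = of_int i" and Y_vmid [simp]: "Y (vmid i j) = of_int j + 1/2"
  using h_pos by (simp_all add: X_def Y_def hmid_def vmid_def midpoint_def pt_def field_simps)

lemma fst_X: "fst p = fst z + h * X p" and snd_Y: "snd p = snd z + h * Y p"
  using h_pos by (simp_all add: X_def Y_def)

lemma sq_hmid: "hmid i j \<in> sq k l \<longleftrightarrow> k = i \<and> (l = j \<or> l = j - 1)"
  unfolding mem_sq by simp linarith

lemma sq_vmid: "vmid i j \<in> sq k l \<longleftrightarrow> (k = i \<or> k = i - 1) \<and> l = j"
  unfolding mem_sq by simp linarith

lemma midpoint_of_hedge: "midpoint_of_edge m (hedge i j) \<longleftrightarrow> m = hmid i j"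
  and midpoint_of_vedge: "midpoint_of_edge m (vedge i j) \<longleftrightarrow> m = vmid i j"
  unfolding hedge_def vedge_def hmid_def vmid_def by (rule midpoint_of_edge_closed_segment)+

lemma pt_Pair: "pt i j = (fst (pt i j), snd (pt i j))"
  "pt (i + 1) j = (fst (pt i j) + h, snd (pt i j))"
  "pt i (j + 1) = (fst (pt i j), snd (pt i j) + h)"
  "pt (i + 1) (j + 1) = (fst (pt i j) + h, snd (pt i j) + h)"
  by (simp_all add: pt_def prod_eq_iff algebra_simps)

lemma sq_cbox: "sq i j = cbox (fst (pt i j), snd (pt i j)) ((fst (pt i j), snd (pt i j)) + (h, h))"
  unfolding lattice_square_def pt_def[symmetric] by simp

lemma edge_of_sq:
  "e edge_of sq i j \<longleftrightarrow> e = hedge i j \<or> e = hedge i (j + 1) \<or> e = vedge i j \<or> e = vedge (i + 1) j"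
  unfolding sq_cbox edge_of_square[OF h_pos] hedge_def vedge_def
  using pt_Pair[of i j] by auto

lemma square_vertices_sq:
  "square_vertices (sq i j) = {pt i j, pt (i + 1) j, pt i (j + 1), pt (i + 1) (j + 1)}"
  unfolding sq_cbox square_vertices_def extreme_point_of_square[OF h_pos]
  using pt_Pair[of i j] by auto

lemma mesh_edges_iff:
  "e \<in> mesh_edges mesh \<longleftrightarrow>
     (\<exists>i j. e = hedge i j \<and> ((i, j) \<in> S \<or> (i, j - 1) \<in> S)) \<or>
     (\<exists>i j. e = vedge i j \<and> ((i, j) \<in> S \<or> (i - 1, j) \<in> S))"
proof -
  have "e \<in> mesh_edges mesh \<longleftrightarrow> (\<exists>i j. (i, j) \<in> S \<and>
      (e = hedge i j \<or> e = hedge i (j + 1) \<or> e = vedge i j \<or> e = vedge (i + 1) j))"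
    unfolding mesh_edges_def mesh_def by (simp add: Bex_def split_paired_Ex edge_of_sq)
  also have "\<dots> \<longleftrightarrow>
     (\<exists>i j. e = hedge i j \<and> ((i, j) \<in> S \<or> (i, j - 1) \<in> S)) \<or>
     (\<exists>i j. e = vedge i j \<and> ((i, j) \<in> S \<or> (i - 1, j) \<in> S))"
    by (metis add_diff_cancel diff_add_cancel)
  finally show ?thesis .
qed

lemma mem_Union_mesh: "p \<in> \<Union>mesh \<longleftrightarrow> (\<exists>i j. (i, j) \<in> S \<and> p \<in> sq i j)"
  unfolding mesh_def by (simp add: Bex_def split_paired_Ex)

lemma closure_domain: "closure domain = \<Union>mesh"
proof
  have "closed (\<Union>mesh)"
    unfolding mesh_def using finite_S closed_sq by (intro closed_Union) auto
  then show "closure domain \<subseteq> \<Union>mesh"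
    unfolding domain_def by (intro closure_minimal interior_subset)
  show "\<Union>mesh \<subseteq> closure domain"
  proof
    fix p assume "p \<in> \<Union>mesh"
    then obtain i j where ij: "(i, j) \<in> S" "p \<in> sq i j"
      by (auto simp only: mem_Union_mesh)
    have "sq i j \<subseteq> \<Union>mesh"
      using ij(1) mem_Union_mesh by blast
    then have "closure (interior (sq i j)) \<subseteq> closure domain"
      unfolding domain_def by (intro closure_mono interior_mono)
    with ij(2) show "p \<in> closure domain"
      by (auto simp: closure_interior_sq)
  qed
qed

lemma frontier_domain: "frontier domain = \<Union>mesh - domain"
  unfolding frontier_def closure_domain by (simp add: domain_def)

lemma convex_sq: "convex (sq i j)"
  unfolding lattice_square_def by (rule convex_box)

lemma hedge_subset: "hedge i j \<subseteq> sq i j \<inter> sq i (j - 1)"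
  and vedge_subset: "vedge i j \<subseteq> sq i j \<inter> sq (i - 1) j"
  unfolding hedge_def vedge_def
  by (intro closed_segment_subset convex_Int convex_sq; simp add: sq_pt)+

lemma hedge_boundary_iff:
  "hedge i j \<in> boundary_edges domain mesh \<longleftrightarrow> ((i, j) \<in> S) \<noteq> ((i, j - 1) \<in> S)"
proof
  assume e: "hedge i j \<in> boundary_edges domain mesh"
  have "hmid i j \<in> hedge i j"
    by (simp add: hmid_def hedge_def)
  then have "hmid i j \<in> \<Union>mesh" "hmid i j \<notin> domain"
    using e unfolding boundary_edges_def frontier_domain by blast+
  then show "((i, j) \<in> S) \<noteq> ((i, j - 1) \<in> S)"
    unfolding mem_Union_mesh mem_domain sq_hmid by auto
next
  assume e: "((i, j) \<in> S) \<noteq> ((i, j - 1) \<in> S)"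
  then have "hedge i j \<in> mesh_edges mesh"
    unfolding mesh_edges_iff by blast
  moreover have "hedge i j \<subseteq> \<Union>mesh - domain"
    using e hedge_subset[of i j] mem_Union_mesh mem_domain by blast
  ultimately show "hedge i j \<in> boundary_edges domain mesh"
    by (simp add: boundary_edges_def frontier_domain)
qed

lemma vedge_boundary_iff:
  "vedge i j \<in> boundary_edges domain mesh \<longleftrightarrow> ((i, j) \<in> S) \<noteq> ((i - 1, j) \<in> S)"
proof
  assume e: "vedge i j \<in> boundary_edges domain mesh"
  have "vmid i j \<in> vedge i j"
    by (simp add: vmid_def vedge_def)
  then have "vmid i j \<in> \<Union>mesh" "vmid i j \<notin> domain"
    using e unfolding boundary_edges_def frontier_domain by blast+
  then show "((i, j) \<in> S) \<noteq> ((i - 1, j) \<in> S)"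
    unfolding mem_Union_mesh mem_domain sq_vmid by auto
next
  assume e: "((i, j) \<in> S) \<noteq> ((i - 1, j) \<in> S)"
  then have "vedge i j \<in> mesh_edges mesh"
    unfolding mesh_edges_iff by blast
  moreover have "vedge i j \<subseteq> \<Union>mesh - domain"
    using e vedge_subset[of i j] mem_Union_mesh mem_domain by blast
  ultimately show "vedge i j \<in> boundary_edges domain mesh"
    by (simp add: boundary_edges_def frontier_domain)
qed

section \<open>The nonconforming space in terms of vertex values\<close>

lemma mem_cells: "p \<in> cells mesh \<longleftrightarrow> (\<exists>i j. (i, j) \<in> S \<and> p \<in> interior (sq i j))"
  unfolding cells_def mesh_def by (simp add: Bex_def split_paired_Ex)

text \<open>Only finitely many open squares are concerned, so the limit exists iff it exists from within each
  of them separately, and a square contributes only if its closure contains the point.\<close>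
lemma limit_from_cells_iff:
  fixes g :: "int \<Rightarrow> int \<Rightarrow> point \<Rightarrow> real"
  assumes v: "\<And>i j p. (i, j) \<in> S \<Longrightarrow> p \<in> interior (sq i j) \<Longrightarrow> v p = g i j p"
    and cont: "\<And>i j. continuous_on UNIV (g i j)"
  shows "(v \<longlongrightarrow> l) (at m within cells mesh) \<longleftrightarrow> (\<forall>i j. (i, j) \<in> S \<and> m \<in> sq i j \<longrightarrow> g i j m = l)"
proof -
  have lim_sq: "(v \<longlongrightarrow> g i j m) (at m within interior (sq i j))" if "(i, j) \<in> S" for i j
  proof -
    have "(g i j \<longlongrightarrow> g i j m) (at m within interior (sq i j))"
      using cont[of i j] unfolding continuous_on_eq_continuous_at[OF open_UNIV] isCont_def
      by (blast intro: tendsto_within_subset)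
    moreover have "\<forall>\<^sub>F p in at m within interior (sq i j). g i j p = v p"
      unfolding eventually_at_filter using v[OF that] by (intro always_eventually) auto
    ultimately show ?thesis
      by (rule Lim_transform_eventually)
  qed
  show ?thesis
  proof (intro iffI allI impI)
    fix i j assume l: "(v \<longlongrightarrow> l) (at m within cells mesh)" and ij: "(i, j) \<in> S \<and> m \<in> sq i j"
    have "interior (sq i j) \<subseteq> cells mesh"
      using ij mem_cells by blast
    then have "(v \<longlongrightarrow> l) (at m within interior (sq i j))"
      using l by (rule tendsto_within_subset[rotated])
    moreover have "at m within interior (sq i j) \<noteq> bot"
    proof -
      have "m \<in> closure (interior (sq i j))"
        using ij by (simp add: closure_interior_sq)
      then have "m islimpt interior (sq i j)"
        using interior_limit_point[of m "interior (sq i j)"] by (auto simp: closure_def)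
      then show ?thesis by (simp add: trivial_limit_within)
    qed
    ultimately show "g i j m = l"
      using lim_sq ij tendsto_unique by blast
  next
    assume *: "\<forall>i j. (i, j) \<in> S \<and> m \<in> sq i j \<longrightarrow> g i j m = l"
    have "(v \<longlongrightarrow> l) (at m within (\<Union>(i, j)\<in>U. interior (sq i j)))" if "finite U" "U \<subseteq> S" for U
      using that
    proof (induction U rule: finite_induct)
      case (insert q U)
      obtain i j where q: "q = (i, j)" by force
      have "(v \<longlongrightarrow> l) (at m within interior (sq i j))"
      proof (cases "m \<in> sq i j")
        case True
        with * insert.prems q lim_sq show ?thesis by fastforce
      next
        case False
        then have "\<not> m islimpt interior (sq i j)"
          using closed_sq[of i j] interior_subset[of "sq i j"] islimpt_subset
          unfolding closed_limpt by blast
        then have "at m within interior (sq i j) = bot"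
          using trivial_limit_within by blast
        then show ?thesis by simp
      qed
      then show ?case
        using insert by (simp add: q Lim_Un)
    qed simp
    from this[OF finite_S] show "(v \<longlongrightarrow> l) (at m within cells mesh)"
      unfolding cells_def mesh_def by (simp add: split_beta)
  qed
qed

text \<open>
  With the pieces outside the mesh set to zero, continuity at the interior midpoints and vanishing at
  those on the boundary become one condition: the pieces on the two sides of every lattice
  edge agree at its midpoint.
\<close>
lemma nonconforming_conditions_iff:
  fixes g :: "int \<Rightarrow> int \<Rightarrow> point \<Rightarrow> real"
  assumes v: "\<And>i j p. (i, j) \<in> S \<Longrightarrow> p \<in> interior (sq i j) \<Longrightarrow> v p = g i j p"
    and cont: "\<And>i j. continuous_on UNIV (g i j)"
    and g0: "\<And>i j p. (i, j) \<notin> S \<Longrightarrow> g i j p = 0"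
  shows "(\<forall>e\<in>mesh_edges mesh. \<forall>m. midpoint_of_edge m e \<longrightarrow> (\<exists>l. (v \<longlongrightarrow> l) (at m within cells mesh))) \<and>
    (\<forall>e\<in>boundary_edges domain mesh. \<forall>m. midpoint_of_edge m e \<longrightarrow> (v \<longlongrightarrow> 0) (at m within cells mesh))
    \<longleftrightarrow> (\<forall>i j. g i j (hmid i j) = g i (j - 1) (hmid i j)) \<and>
        (\<forall>i j. g i j (vmid i j) = g (i - 1) j (vmid i j))" (is "?C \<and> ?B \<longleftrightarrow> ?H \<and> ?V")
proof -
  have lim: "(v \<longlongrightarrow> l) (at m within cells mesh) \<longleftrightarrow>
      (\<forall>i j. (i, j) \<in> S \<and> m \<in> sq i j \<longrightarrow> g i j m = l)" for l m
    by (rule limit_from_cells_iff) (fact v, fact cont)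
  have limh: "(v \<longlongrightarrow> l) (at (hmid i j) within cells mesh) \<longleftrightarrow>
      ((i, j) \<in> S \<longrightarrow> g i j (hmid i j) = l) \<and> ((i, j - 1) \<in> S \<longrightarrow> g i (j - 1) (hmid i j) = l)" for i j l
    unfolding lim sq_hmid by auto
  have limv: "(v \<longlongrightarrow> l) (at (vmid i j) within cells mesh) \<longleftrightarrow>
      ((i, j) \<in> S \<longrightarrow> g i j (vmid i j) = l) \<and> ((i - 1, j) \<in> S \<longrightarrow> g (i - 1) j (vmid i j) = l)" for i j l
    unfolding lim sq_vmid by auto
  have edge: "e \<in> boundary_edges domain mesh \<Longrightarrow> e \<in> mesh_edges mesh" for e
    by (simp add: boundary_edges_def)
  have C: "?C \<longleftrightarrow>
      (\<forall>i j. (i, j) \<in> S \<or> (i, j - 1) \<in> S \<longrightarrow> (\<exists>l. (v \<longlongrightarrow> l) (at (hmid i j) within cells mesh))) \<and>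
      (\<forall>i j. (i, j) \<in> S \<or> (i - 1, j) \<in> S \<longrightarrow> (\<exists>l. (v \<longlongrightarrow> l) (at (vmid i j) within cells mesh)))"
    (is "_ \<longleftrightarrow> ?R")
  proof
    assume ?C
    moreover have "hedge i j \<in> mesh_edges mesh" if "(i, j) \<in> S \<or> (i, j - 1) \<in> S" for i j
      using that unfolding mesh_edges_iff by blast
    moreover have "vedge i j \<in> mesh_edges mesh" if "(i, j) \<in> S \<or> (i - 1, j) \<in> S" for i j
      using that unfolding mesh_edges_iff by blast
    ultimately show ?R
      using midpoint_of_hedge midpoint_of_vedge by blast
  next
    assume R: ?R
    show ?C
    proof (intro ballI allI impI)
      fix e m assume e: "e \<in> mesh_edges mesh" and m: "midpoint_of_edge m e"
      from e consider i j where "e = hedge i j" "(i, j) \<in> S \<or> (i, j - 1) \<in> S"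
        | i j where "e = vedge i j" "(i, j) \<in> S \<or> (i - 1, j) \<in> S"
        unfolding mesh_edges_iff by blast
      then show "\<exists>l. (v \<longlongrightarrow> l) (at m within cells mesh)"
      proof cases
        case 1
        then have "m = hmid i j" using m midpoint_of_hedge by simp
        with 1 conjunct1[OF R] show ?thesis by blast
      next
        case 2
        then have "m = vmid i j" using m midpoint_of_vedge by simp
        with 2 conjunct2[OF R] show ?thesis by blast
      qed
    qed
  qed
  have B: "?B \<longleftrightarrow>
      (\<forall>i j. ((i, j) \<in> S) \<noteq> ((i, j - 1) \<in> S) \<longrightarrow> (v \<longlongrightarrow> 0) (at (hmid i j) within cells mesh)) \<and>
      (\<forall>i j. ((i, j) \<in> S) \<noteq> ((i - 1, j) \<in> S) \<longrightarrow> (v \<longlongrightarrow> 0) (at (vmid i j) within cells mesh))"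
    (is "_ \<longleftrightarrow> ?R")
  proof
    assume ?B
    then show ?R
      using hedge_boundary_iff midpoint_of_hedge vedge_boundary_iff midpoint_of_vedge by blast
  next
    assume R: ?R
    show ?B
    proof (intro ballI allI impI)
      fix e m assume e: "e \<in> boundary_edges domain mesh" and m: "midpoint_of_edge m e"
      from edge[OF e] obtain i j where "e = hedge i j \<or> e = vedge i j"
        unfolding mesh_edges_iff by blast
      then show "(v \<longlongrightarrow> 0) (at m within cells mesh)"
      proof
        assume e_eq: "e = hedge i j"
        have "((i, j) \<in> S) \<noteq> ((i, j - 1) \<in> S)"
          using e unfolding e_eq hedge_boundary_iff .
        moreover have "m = hmid i j"
          using m unfolding e_eq midpoint_of_hedge .
        ultimately show ?thesis using conjunct1[OF R] by blast
      next
        assume e_eq: "e = vedge i j"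
        have "((i, j) \<in> S) \<noteq> ((i - 1, j) \<in> S)"
          using e unfolding e_eq vedge_boundary_iff .
        moreover have "m = vmid i j"
          using m unfolding e_eq midpoint_of_vedge .
        ultimately show ?thesis using conjunct2[OF R] by blast
      qed
    qed
  qed
  have logic: "((A \<or> B \<longrightarrow> (\<exists>l. (A \<longrightarrow> x = l) \<and> (B \<longrightarrow> y = l))) \<and>
      (A \<noteq> B \<longrightarrow> (A \<longrightarrow> x = 0) \<and> (B \<longrightarrow> y = 0))) \<longleftrightarrow> x = y"
    if "\<not> A \<longrightarrow> x = 0" "\<not> B \<longrightarrow> y = 0" for A B and x y :: real
    using that by auto
  have g0': "(i, j) \<notin> S \<longrightarrow> g i j p = 0" for i j p
    using g0 by blast
  have "?C \<and> ?B \<longleftrightarrow>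
     (\<forall>i j. ((i, j) \<in> S \<or> (i, j - 1) \<in> S \<longrightarrow> (\<exists>l. (v \<longlongrightarrow> l) (at (hmid i j) within cells mesh))) \<and>
            (((i, j) \<in> S) \<noteq> ((i, j - 1) \<in> S) \<longrightarrow> (v \<longlongrightarrow> 0) (at (hmid i j) within cells mesh))) \<and>
     (\<forall>i j. ((i, j) \<in> S \<or> (i - 1, j) \<in> S \<longrightarrow> (\<exists>l. (v \<longlongrightarrow> l) (at (vmid i j) within cells mesh))) \<and>
            (((i, j) \<in> S) \<noteq> ((i - 1, j) \<in> S) \<longrightarrow> (v \<longlongrightarrow> 0) (at (vmid i j) within cells mesh)))"
    unfolding C B by blast
  also have "\<dots> \<longleftrightarrow> ?H \<and> ?V"
    unfolding limh limv by (simp only: logic[OF g0' g0'])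
  finally show ?thesis .
qed

text \<open>The affine function on a square whose value at the midpoint of each edge is the sum of the values
  of \<open>a\<close> at the ends of that edge (\<open>nc_affine_hmid\<close>, \<open>nc_affine_vmid\<close>).\<close>
definition nc_affine :: "(int \<Rightarrow> int \<Rightarrow> real) \<Rightarrow> int \<Rightarrow> int \<Rightarrow> point \<Rightarrow> real" where
  "nc_affine a i j p =
     (3/2 - (X p - of_int i) - (Y p - of_int j)) * a i j +
     (1/2 + (X p - of_int i) - (Y p - of_int j)) * a (i + 1) j +
     (1/2 - (X p - of_int i) + (Y p - of_int j)) * a i (j + 1) +
     ((X p - of_int i) + (Y p - of_int j) - 1/2) * a (i + 1) (j + 1)"

definition nc_fun :: "(int \<Rightarrow> int \<Rightarrow> real) \<Rightarrow> point \<Rightarrow> real" where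
  "nc_fun a p = (\<Sum>(i, j)\<in>S. indicat_real (interior (sq i j)) p * nc_affine a i j p)"

lemma nc_fun_on_square:
  assumes "(i, j) \<in> S" "p \<in> interior (sq i j)"
  shows "nc_fun a p = nc_affine a i j p"
proof -
  have "nc_fun a p = (\<Sum>q\<in>S. if q = (i, j) then nc_affine a i j p else 0)"
    unfolding nc_fun_def
  proof (rule sum.cong)
    fix q assume "q \<in> S"
    obtain k l where q: "q = (k, l)" by force
    have "p \<in> interior (sq k l) \<longleftrightarrow> k = i \<and> l = j"
      using interior_sq_unique[OF assms(2)] interior_subset assms(2) by blast
    then show "(case q of (i, j) \<Rightarrow> indicat_real (interior (sq i j)) p * nc_affine a i j p) =
        (if q = (i, j) then nc_affine a i j p else 0)"
      by (simp add: q indicator_def)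
  qed simp
  also have "\<dots> = nc_affine a i j p"
    using assms(1) finite_S by simp
  finally show ?thesis .
qed

lemma nc_fun_off_cells: "p \<notin> cells mesh \<Longrightarrow> nc_fun a p = 0"
  unfolding nc_fun_def by (intro sum.neutral) (auto simp: mem_cells)

lemma continuous_nc_affine: "continuous_on A (nc_affine a i j)"
  unfolding nc_affine_def by (intro continuous_intros)

lemma nc_affine_outside:
  assumes "a \<in> vertex_functions" "(i, j) \<notin> S"
  shows "nc_affine a i j p = 0"
  using assms by (simp add: nc_affine_def vertex_functions_def interior_vertex_def)

text \<open>If all sums over edges vanish, \<open>a\<close> changes sign with every step along a row, and it is zero to
  the left of the mesh.\<close>
lemma nc_fun_zero:
  assumes a: "a \<in> vertex_functions" and z: "nc_fun a = 0"
  shows "a = 0"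
proof -
  obtain M where M: "\<And>i j. (i, j) \<in> S \<Longrightarrow> M < i"
    using left_of_mesh by blast
  have aff: "nc_affine a i j p = 0" if p: "p \<in> sq i j" for i j p
  proof (cases "(i, j) \<in> S")
    case True
    have "nc_affine a i j r = 0" if "r \<in> interior (sq i j)" for r
      using nc_fun_on_square[OF True that, of a] fun_cong[OF z, of r] by simp
    moreover have "p \<in> closure (interior (sq i j))"
      using p closure_interior_sq by simp
    ultimately show ?thesis
      by (rule continuous_constant_on_closure[OF continuous_nc_affine])
  qed (simp add: nc_affine_outside[OF a])
  have "a i j = 0" for i j
  proof (rule lattice_propagate_zero[where c = "-1" and d = 0 and M = M])
    fix i j :: int assume "i \<le> M"
    then have "\<not> interior_vertex i j"
      using M by (fastforce simp: interior_vertex_def)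
    with a show "a i j = 0"
      by (simp add: vertex_functions_def)
  next
    fix i j
    have "nc_affine a (i - 1) j (pt (i - 1) j) = 0" "nc_affine a (i - 1) j (pt i j) = 0"
      by (rule aff, simp add: sq_pt)+
    then have "3/2 * a (i - 1) j + 1/2 * a i j + 1/2 * a (i - 1) (j + 1) - 1/2 * a i (j + 1) = 0"
      and "1/2 * a (i - 1) j + 3/2 * a i j - 1/2 * a (i - 1) (j + 1) + 1/2 * a i (j + 1) = 0"
      by (simp_all add: nc_affine_def)
    then show "a i j = - 1 * a (i - 1) (j - 0)"
      by simp
  qed
  then show ?thesis by (intro ext) simp
qed

lemma nc_affine_hmid: "nc_affine a i j (hmid i j) = a i j + a (i + 1) j"
    "nc_affine a i (j - 1) (hmid i j) = a i j + a (i + 1) j"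
  and nc_affine_vmid: "nc_affine a i j (vmid i j) = a i j + a i (j + 1)"
    "nc_affine a (i - 1) j (vmid i j) = a i j + a i (j + 1)"
  by (simp_all add: nc_affine_def)

lemma nc_affine_in_P1: "nc_affine a i j \<in> P1"
proof -
  define s where "s = (- fst z / h) - of_int i"
  define t where "t = (- snd z / h) - of_int j"
  have X: "X p - of_int i = fst p / h + s" and Y: "Y p - of_int j = snd p / h + t" for p
    by (simp_all add: X_def Y_def s_def t_def diff_divide_distrib)
  show ?thesis
    unfolding P1_iff
  proof (intro exI ext)
    fix p
    show "nc_affine a i j p =
       ((3/2 - s - t) * a i j + (1/2 + s - t) * a (i + 1) j + (1/2 - s + t) * a i (j + 1)
          + (s + t - 1/2) * a (i + 1) (j + 1))
       + ((- a i j + a (i + 1) j - a i (j + 1) + a (i + 1) (j + 1)) / h) * fst p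
       + ((- a i j - a (i + 1) j + a i (j + 1) + a (i + 1) (j + 1)) / h) * snd p"
      unfolding nc_affine_def X Y by (simp add: algebra_simps add_divide_distrib diff_divide_distrib)
  qed
qed

lemma nc_fun_measurable: "nc_fun a \<in> borel_measurable (lebesgue_on A)"
proof -
  have "(\<lambda>p. \<Sum>q\<in>S. indicat_real (interior (sq (fst q) (snd q))) p * nc_affine a (fst q) (snd q) p)
      \<in> borel_measurable borel"
    by (intro borel_measurable_sum borel_measurable_times borel_measurable_indicator
        borel_measurable_continuous_onI continuous_nc_affine) simp
  then have "nc_fun a \<in> borel_measurable lborel"
    unfolding nc_fun_def by (simp add: split_beta)
  then have "nc_fun a \<in> borel_measurable lebesgue"
    by (rule measurable_completion)
  then show ?thesis
    by (rule measurable_restrict_space1)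
qed

lemma nc_fun_bounded: "\<exists>B. \<forall>p. \<bar>nc_fun a p\<bar> \<le> B"
proof -
  have "\<exists>B. \<forall>p\<in>sq i j. \<bar>nc_affine a i j p\<bar> \<le> B" for i j
  proof -
    have "compact (sq i j)"
      unfolding lattice_square_def by (rule compact_cbox)
    then have "bounded (nc_affine a i j ` sq i j)"
      by (intro compact_imp_bounded compact_continuous_image continuous_nc_affine)
    then show ?thesis
      by (simp add: bounded_iff)
  qed
  then obtain B where B: "\<And>i j p. p \<in> sq i j \<Longrightarrow> \<bar>nc_affine a i j p\<bar> \<le> B i j"
    by metis
  have "\<bar>nc_fun a p\<bar> \<le> (\<Sum>(i, j)\<in>S. \<bar>B i j\<bar>)" for p
    unfolding nc_fun_def
  proof (rule order_trans[OF sum_abs sum_mono], clarify)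
    fix i j
    show "\<bar>indicat_real (interior (sq i j)) p * nc_affine a i j p\<bar> \<le> \<bar>B i j\<bar>"
      using B[of p i j] interior_subset[of "sq i j"] by (auto simp: indicator_def)
  qed
  then show ?thesis by blast
qed

lemma bounded_domain: "bounded domain"
proof -
  have "bounded (\<Union>mesh)"
    unfolding mesh_def using finite_S
    by (intro bounded_Union) (auto simp: lattice_square_def intro!: bounded_cbox)
  then show ?thesis
    unfolding domain_def using interior_subset by (rule bounded_subset)
qed

lemma nc_fun_square_integrable: "square_integrable domain (nc_fun a)"
  unfolding square_integrable_def
proof
  show m: "nc_fun a \<in> borel_measurable (lebesgue_on domain)"
    by (rule nc_fun_measurable)
  obtain B where B: "\<And>p. \<bar>nc_fun a p\<bar> \<le> B"
    using nc_fun_bounded by blast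
  have "domain \<in> lmeasurable"
    using bounded_domain by (intro lmeasurable_open) (simp_all add: domain_def)
  then interpret finite_measure "lebesgue_on domain"
    by (rule finite_measure_lebesgue_on)
  show "integrable (lebesgue_on domain) (\<lambda>p. (nc_fun a p)\<^sup>2)"
  proof (rule integrable_const_bound)
    have "norm ((nc_fun a p)\<^sup>2) \<le> B\<^sup>2" for p
      using power_mono[OF B[of p], of 2] by simp
    then show "AE p in lebesgue_on domain. norm ((nc_fun a p)\<^sup>2) \<le> B\<^sup>2"
      by simp
    show "(\<lambda>p. (nc_fun a p)\<^sup>2) \<in> borel_measurable (lebesgue_on domain)"
      using m by measurable
  qed
qed

lemma nc_fun_in_NC0:
  assumes a: "a \<in> vertex_functions"
  shows "nc_fun a \<in> NC0 domain mesh"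
proof -
  have "\<forall>Q\<in>mesh. \<exists>g\<in>P1. \<forall>p\<in>interior Q. nc_fun a p = g p"
    unfolding mesh_def using nc_fun_on_square nc_affine_in_P1 by fastforce
  moreover have "(\<forall>e\<in>mesh_edges mesh. \<forall>m. midpoint_of_edge m e \<longrightarrow>
        (\<exists>l. (nc_fun a \<longlongrightarrow> l) (at m within cells mesh))) \<and>
      (\<forall>e\<in>boundary_edges domain mesh. \<forall>m. midpoint_of_edge m e \<longrightarrow>
        (nc_fun a \<longlongrightarrow> 0) (at m within cells mesh))"
    by (subst nonconforming_conditions_iff[where g = "nc_affine a"])
      (simp_all add: nc_fun_on_square continuous_nc_affine nc_affine_outside[OF a]
        nc_affine_hmid nc_affine_vmid)
  ultimately show ?thesis
    unfolding NC0_def NC_def using nc_fun_square_integrable nc_fun_off_cells by blast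
qed

lemma affine_in_lattice_coordinates:
  assumes "\<And>p. g p = \<alpha> + \<beta> * fst p + \<gamma> * snd p"
  obtains A B C :: real where "\<And>p. g p = A + B * X p + C * Y p"
proof
  fix p
  show "g p = (\<alpha> + \<beta> * fst z + \<gamma> * snd z) + (\<beta> * h) * X p + (\<gamma> * h) * Y p"
    unfolding assms fst_X[of p] snd_Y[of p] by (simp add: algebra_simps)
qed

text \<open>An affine function on a square is determined by its values at the edge midpoints: opposite
  midpoints give the two slopes and the value at the centre.\<close>
lemma affine_eq_nc_affine:
  assumes g: "\<And>p. g p = A + B * X p + C * Y p"
    and H: "g (hmid i j) = a i j + a (i + 1) j" "g (hmid i (j + 1)) = a i (j + 1) + a (i + 1) (j + 1)"
    and V: "g (vmid i j) = a i j + a i (j + 1)" "g (vmid (i + 1) j) = a (i + 1) j + a (i + 1) (j + 1)"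
  shows "g p = nc_affine a i j p"
proof -
  have "g p = (g (vmid i j) + g (vmid (i + 1) j)) / 2
      + (g (vmid (i + 1) j) - g (vmid i j)) * (X p - of_int i - 1/2)
      + (g (hmid i (j + 1)) - g (hmid i j)) * (Y p - of_int j - 1/2)"
    unfolding g by (simp add: field_simps)
  then show ?thesis
    unfolding H V nc_affine_def by (simp add: field_simps)
qed

text \<open>Midpoints of opposite edges are symmetric about the centre of the square, so the pieces of a
  nonconforming function satisfy the hypothesis of \<open>vertex_potential\<close>.\<close>
lemma NC0_subset:
  assumes conn: "connected (- domain)" and v: "v \<in> NC0 domain mesh"
  shows "v \<in> nc_fun ` vertex_functions"
proof -
  have "\<exists>\<alpha> \<beta> \<gamma>. (i, j) \<in> S \<longrightarrow> (\<forall>p\<in>interior (sq i j). v p = \<alpha> + \<beta> * fst p + \<gamma> * snd p)" for i j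
  proof (cases "(i, j) \<in> S")
    case True
    then have "sq i j \<in> mesh"
      unfolding mesh_def by force
    then obtain g where "g \<in> P1" "\<forall>p\<in>interior (sq i j). v p = g p"
      using v unfolding NC0_def NC_def by blast
    then show ?thesis
      unfolding P1_iff by auto
  qed simp
  then obtain \<alpha> \<beta> \<gamma> where v_affine:
    "\<And>i j p. (i, j) \<in> S \<Longrightarrow> p \<in> interior (sq i j) \<Longrightarrow> v p = \<alpha> i j + \<beta> i j * fst p + \<gamma> i j * snd p"
    by metis
  \<comment> \<open>The zero extension to the squares outside the mesh turns the boundary conditions into matching
    conditions.\<close>
  define g where "g i j p = (if (i, j) \<in> S then \<alpha> i j + \<beta> i j * fst p + \<gamma> i j * snd p else 0)" for i j and p :: point
  have g_out: "g i j p = 0" if "(i, j) \<notin> S" for i j p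
    using that by (simp add: g_def)
  have vg: "v p = g i j p" if "(i, j) \<in> S" "p \<in> interior (sq i j)" for i j p
    using v_affine[OF that] that by (simp add: g_def)
  have cont: "continuous_on UNIV (g i j)" for i j
    unfolding g_def by (cases "(i, j) \<in> S") (auto intro!: continuous_intros)
  have affine: "\<exists>\<alpha> \<beta> \<gamma>. \<forall>p. g i j p = \<alpha> + \<beta> * fst p + \<gamma> * snd p" for i j
  proof (cases "(i, j) \<in> S")
    case False
    then show ?thesis
      by (intro exI[of _ 0]) (simp add: g_def)
  qed (auto simp: g_def)
  have match: "(\<forall>i j. g i j (hmid i j) = g i (j - 1) (hmid i j)) \<and>
        (\<forall>i j. g i j (vmid i j) = g (i - 1) j (vmid i j))"
    by (rule iffD1[OF nonconforming_conditions_iff[where g = g and v = v, OF vg cont g_out]])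
      (use v in \<open>auto simp: NC0_def NC_def\<close>)
  have "\<exists>a. (\<forall>i j. \<not> interior_vertex i j \<longrightarrow> a i j = 0) \<and>
      (\<forall>i j. a i j + a (i + 1) j = g i j (hmid i j)) \<and> (\<forall>i j. a i j + a i (j + 1) = g i j (vmid i j))"
  proof (rule vertex_potential[OF conn])
    fix i j
    show "g i j (hmid i j) = 0" if "\<not> ((i, j) \<in> S \<and> (i, j - 1) \<in> S)"
      using that match g_out by metis
    show "g i j (vmid i j) = 0" if "\<not> ((i, j) \<in> S \<and> (i - 1, j) \<in> S)"
      using that match g_out by metis
    obtain A B C where g: "\<And>p. g i j p = A + B * X p + C * Y p"
      using affine affine_in_lattice_coordinates by metis
    have "g i j (vmid i j) + g i j (vmid (i + 1) j) = g i j (hmid i j) + g i j (hmid i (j + 1))"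
      unfolding g by (simp add: field_simps)
    moreover have "g (i + 1) j (vmid (i + 1) j) = g i j (vmid (i + 1) j)"
      using match by (metis add_diff_cancel_right')
    moreover have "g i (j + 1) (hmid i (j + 1)) = g i j (hmid i (j + 1))"
      using match by (metis add_diff_cancel_right')
    ultimately show "g i j (vmid i j) + g (i + 1) j (vmid (i + 1) j) =
        g i j (hmid i j) + g i (j + 1) (hmid i (j + 1))"
      by simp
  qed
  then obtain a where a: "a \<in> vertex_functions"
    and aH: "\<And>i j. a i j + a (i + 1) j = g i j (hmid i j)"
    and aV: "\<And>i j. a i j + a i (j + 1) = g i j (vmid i j)"
    unfolding vertex_functions_def by blast
  have "v p = nc_fun a p" for p
  proof (cases "p \<in> cells mesh")
    case True
    then obtain i j where ij: "(i, j) \<in> S" "p \<in> interior (sq i j)"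
      unfolding mem_cells by blast
    obtain A B C where g: "\<And>p. g i j p = A + B * X p + C * Y p"
      using affine affine_in_lattice_coordinates by metis
    have "g i j p = nc_affine a i j p"
    proof (rule affine_eq_nc_affine[OF g])
      show "g i j (hmid i (j + 1)) = a i (j + 1) + a (i + 1) (j + 1)"
        using match aH by (metis add_diff_cancel_right')
      show "g i j (vmid (i + 1) j) = a (i + 1) j + a (i + 1) (j + 1)"
        using match aV by (metis add_diff_cancel_right')
    qed (simp_all add: aH aV)
    then show ?thesis
      using nc_fun_on_square[OF ij] vg[OF ij] by simp
  next
    case False
    then have "v p = 0"
      using v unfolding NC0_def NC_def by blast
    then show ?thesis
      using nc_fun_off_cells[OF False] by simp
  qed
  with a show ?thesis by blast
qed

theorem NC0_eq:
  assumes "connected (- domain)"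
  shows "NC0 domain mesh = nc_fun ` vertex_functions"
  using NC0_subset[OF assms] nc_fun_in_NC0 by blast

section \<open>Divergence-free fields are discrete curls\<close>

lemma div_h_nc_fun:
  assumes ij: "(i, j) \<in> S" and p: "p \<in> interior (sq i j)"
  shows "div_h mesh (\<lambda>p. (nc_fun a p, nc_fun b p)) p = lattice_div a b i j / h"
proof -
  have [simp]: "h \<noteq> 0"
    using h_pos by simp
  have X: "X (x, y) = (x - fst z) / h" and Y: "Y (x, y) = (y - snd z) / h" for x y
    by (simp_all add: X_def Y_def)
  have dx: "((\<lambda>x. nc_fun a (x, snd p)) has_field_derivative
      (a (i + 1) j + a (i + 1) (j + 1) - a i j - a i (j + 1)) / h) (at (fst p))"
  proof (rule has_field_derivative_transform_within_open)
    show "((\<lambda>x. nc_affine a i j (x, snd p)) has_field_derivative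
        (a (i + 1) j + a (i + 1) (j + 1) - a i j - a i (j + 1)) / h) (at (fst p))"
      unfolding nc_affine_def X Y
      by (auto intro!: derivative_eq_intros simp: field_simps)
    show "open {x. (x, snd p) \<in> interior (sq i j)}"
      using open_vimage[OF open_interior, of "\<lambda>x. (x, snd p)" "sq i j"]
      by (simp add: vimage_def continuous_intros)
    show "fst p \<in> {x. (x, snd p) \<in> interior (sq i j)}"
      using p by simp
    show "nc_affine a i j (x, snd p) = nc_fun a (x, snd p)"
      if "x \<in> {x. (x, snd p) \<in> interior (sq i j)}" for x
      using that nc_fun_on_square[OF ij] by simp
  qed
  have dy: "((\<lambda>y. nc_fun b (fst p, y)) has_field_derivative
      (b i (j + 1) + b (i + 1) (j + 1) - b i j - b (i + 1) j) / h) (at (snd p))"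
  proof (rule has_field_derivative_transform_within_open)
    show "((\<lambda>y. nc_affine b i j (fst p, y)) has_field_derivative
        (b i (j + 1) + b (i + 1) (j + 1) - b i j - b (i + 1) j) / h) (at (snd p))"
      unfolding nc_affine_def X Y
      by (auto intro!: derivative_eq_intros simp: field_simps)
    show "open {y. (fst p, y) \<in> interior (sq i j)}"
      using open_vimage[OF open_interior, of "\<lambda>y. (fst p, y)" "sq i j"]
      by (simp add: vimage_def continuous_intros)
    show "snd p \<in> {y. (fst p, y) \<in> interior (sq i j)}"
      using p by simp
    show "nc_affine b i j (fst p, y) = nc_fun b (fst p, y)"
      if "y \<in> {y. (fst p, y) \<in> interior (sq i j)}" for y
      using that nc_fun_on_square[OF ij] by simp
  qed
  have "p \<in> cells mesh"
    unfolding mem_cells using ij p by blast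
  then show ?thesis
    unfolding div_h_def divergence_def
    using DERIV_imp_deriv[OF dx] DERIV_imp_deriv[OF dy]
    by (simp add: lattice_div_def add_divide_distrib)
qed

lemma div_h_nc_fun_eq_0_iff:
  assumes "a \<in> vertex_functions" "b \<in> vertex_functions"
  shows "div_h mesh (\<lambda>p. (nc_fun a p, nc_fun b p)) = (\<lambda>p. 0) \<longleftrightarrow> (\<forall>i j. lattice_div a b i j = 0)"
proof
  assume 0: "div_h mesh (\<lambda>p. (nc_fun a p, nc_fun b p)) = (\<lambda>p. 0)"
  show "\<forall>i j. lattice_div a b i j = 0"
  proof (intro allI)
    fix i j
    show "lattice_div a b i j = 0"
    proof (cases "(i, j) \<in> S")
      case True
      have "interior (sq i j) \<noteq> {}"
        using closure_interior_sq[of i j] sq_pt[of i j i j] by (metis closure_empty empty_iff)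
      then obtain p where "p \<in> interior (sq i j)" by blast
      from div_h_nc_fun[OF True this, of a b] fun_cong[OF 0, of p] show ?thesis
        using h_pos by simp
    next
      case False
      then show ?thesis
        using assms by (simp add: lattice_div_def vertex_functions_def interior_vertex_def)
    qed
  qed
next
  assume 0: "\<forall>i j. lattice_div a b i j = 0"
  show "div_h mesh (\<lambda>p. (nc_fun a p, nc_fun b p)) = (\<lambda>p. 0)"
  proof
    fix p
    show "div_h mesh (\<lambda>p. (nc_fun a p, nc_fun b p)) p = 0"
    proof (cases "p \<in> cells mesh")
      case True
      then obtain i j where "(i, j) \<in> S" "p \<in> interior (sq i j)"
        unfolding mem_cells by blast
      from div_h_nc_fun[OF this] 0 show ?thesis by simp
    qed (simp add: div_h_def)
  qed
qed

definition curl_field :: "(int \<Rightarrow> int \<Rightarrow> real) \<Rightarrow> point \<Rightarrow> point" where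
  "curl_field \<psi> p = (nc_fun (curl1 \<psi>) p, nc_fun (curl2 \<psi>) p)"

theorem V_h_eq_curl_fields:
  assumes conn: "connected (- domain)"
  shows "V_h domain mesh = curl_field ` stream_functions"
proof (intro equalityI subsetI)
  fix v assume v: "v \<in> V_h domain mesh"
  then obtain a b where a: "a \<in> vertex_functions" "(\<lambda>p. fst (v p)) = nc_fun a"
    and b: "b \<in> vertex_functions" "(\<lambda>p. snd (v p)) = nc_fun b"
    and div: "div_h mesh v = (\<lambda>p. 0)"
    unfolding V_h_def NC0_eq[OF conn] by auto
  have v_eq: "v = (\<lambda>p. (nc_fun a p, nc_fun b p))"
    using fun_cong[OF a(2)] fun_cong[OF b(2)] by (intro ext) (simp add: prod_eq_iff)
  have "lattice_div a b i j = 0" for i j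
    using div div_h_nc_fun_eq_0_iff[OF a(1) b(1)] unfolding v_eq by blast
  from stream_function_exists[OF conn a(1) b(1) this] obtain \<psi>
    where "\<psi> \<in> stream_functions" "a = curl1 \<psi>" "b = curl2 \<psi>"
    by blast
  then show "v \<in> curl_field ` stream_functions"
    unfolding v_eq curl_field_def by blast
next
  fix v assume "v \<in> curl_field ` stream_functions"
  then obtain \<psi> where \<psi>: "\<psi> \<in> stream_functions" and v: "v = curl_field \<psi>"
    by blast
  have "div_h mesh (curl_field \<psi>) = (\<lambda>p. 0)"
    unfolding curl_field_def
    using div_h_nc_fun_eq_0_iff[OF curl_vertex_functions[OF \<psi>]] div_curl by blast
  then show "v \<in> V_h domain mesh"
    unfolding V_h_def v using curl_vertex_functions[OF \<psi>]
    by (auto simp: NC0_eq[OF conn] curl_field_def)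
qed

section \<open>The dimension\<close>

lemma linear_nc_fun: "linear nc_fun"
proof (rule linearI)
  have add: "nc_affine (a + b) i j p = nc_affine a i j p + nc_affine b i j p" for a b i j p
    by (simp add: nc_affine_def algebra_simps)
  have scale: "nc_affine (c *\<^sub>R a) i j p = c * nc_affine a i j p" for a c i j p
    by (simp add: nc_affine_def scaleR_fun_def algebra_simps)
  fix a b and c :: real
  show "nc_fun (a + b) = nc_fun a + nc_fun b"
    by (simp add: fun_eq_iff nc_fun_def add split_beta sum.distrib distrib_left)
  show "nc_fun (c *\<^sub>R a) = c *\<^sub>R nc_fun a"
    by (simp add: fun_eq_iff scaleR_fun_def[of c "nc_fun a"] nc_fun_def scale split_beta
        sum_distrib_left mult.left_commute)
qed

lemma linear_curl1: "linear curl1" and linear_curl2: "linear curl2"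
  by (rule linearI; simp add: fun_eq_iff scaleR_fun_def curl1_def curl2_def algebra_simps)+

lemma linear_curl_field: "linear curl_field"
proof (rule linearI)
  fix \<psi> \<phi> and c :: real
  show "curl_field (\<psi> + \<phi>) = curl_field \<psi> + curl_field \<phi>"
    by (simp add: fun_eq_iff curl_field_def linear_add[OF linear_curl1] linear_add[OF linear_curl2]
        linear_add[OF linear_nc_fun])
  show "curl_field (c *\<^sub>R \<psi>) = c *\<^sub>R curl_field \<psi>"
    unfolding fun_eq_iff curl_field_def linear_scale[OF linear_curl1] linear_scale[OF linear_curl2]
      linear_scale[OF linear_nc_fun] by (simp add: scaleR_fun_def)
qed

lemma subspace_stream_functions: "subspace stream_functions"
  by (rule subspaceI) (auto simp: stream_functions_def scaleR_fun_def)

lemma inj_on_curl_field: "inj_on curl_field stream_functions"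
  unfolding linear_inj_on_iff_eq_0[OF linear_curl_field subspace_stream_functions]
proof (intro ballI impI)
  fix \<psi> assume \<psi>: "\<psi> \<in> stream_functions" and "curl_field \<psi> = 0"
  then have "nc_fun (curl1 \<psi>) = 0" "nc_fun (curl2 \<psi>) = 0"
    by (auto simp: curl_field_def fun_eq_iff zero_prod_def)
  then show "\<psi> = 0"
    using \<psi> curl_vertex_functions[OF \<psi>] nc_fun_zero curl_injective by blast
qed

text \<open>A vertex of the mesh lies either on the boundary or in the domain, and the vertices in the domain
  are those that are surrounded by four squares.\<close>
lemma card_interior_squares:
  "card (interior_squares domain mesh) = card {(i, j). interior_square i j}"
proof -
  have vertex: "p \<in> mesh_vertices mesh \<and> p \<notin> frontier domain \<longleftrightarrow> (p \<in> mesh_vertices mesh \<and> p \<in> domain)" for p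
  proof -
    have "p \<in> \<Union>mesh" if "p \<in> mesh_vertices mesh"
      using that unfolding mesh_vertices_def square_vertices_def extreme_point_of_def by blast
    then show ?thesis
      unfolding frontier_domain by blast
  qed
  have "sq i j \<in> interior_squares domain mesh \<longleftrightarrow> interior_square i j" if "(i, j) \<in> S" for i j
  proof -
    have Q: "sq i j \<in> mesh"
      using that unfolding mesh_def by force
    then have "square_vertices (sq i j) \<subseteq> mesh_vertices mesh"
      unfolding mesh_vertices_def by blast
    then have "square_vertices (sq i j) \<subseteq> interior_vertices domain mesh \<longleftrightarrow>
        square_vertices (sq i j) \<subseteq> domain"
      unfolding interior_vertices_def boundary_vertices_def using vertex by blast
    then show ?thesis
      using Q by (simp add: interior_squares_def square_vertices_sq pt_mem_domain interior_square_def)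
  qed
  note interior = this
  have "interior_squares domain mesh = (\<lambda>(i, j). sq i j) ` {(i, j). (i, j) \<in> S \<and> interior_square i j}"
  proof (intro equalityI subsetI)
    fix Q assume Q: "Q \<in> interior_squares domain mesh"
    then obtain i j where "(i, j) \<in> S" "Q = sq i j"
      unfolding interior_squares_def mesh_def by auto
    with Q show "Q \<in> (\<lambda>(i, j). sq i j) ` {(i, j). (i, j) \<in> S \<and> interior_square i j}"
      using interior by blast
  next
    fix Q assume "Q \<in> (\<lambda>(i, j). sq i j) ` {(i, j). (i, j) \<in> S \<and> interior_square i j}"
    then show "Q \<in> interior_squares domain mesh"
      using interior by auto
  qed
  moreover have "{(i, j). (i, j) \<in> S \<and> interior_square i j} = {(i, j). interior_square i j}"
    by (auto simp: interior_square_def interior_vertex_def)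
  ultimately show ?thesis
    using card_image[OF inj_on_subset[OF inj_lattice_square[OF h_pos] subset_UNIV]] by metis
qed

definition unit_stream :: "int \<times> int \<Rightarrow> int \<Rightarrow> int \<Rightarrow> real" where
  "unit_stream q k l = (if q = (k, l) then 1 else 0)"

lemma sum_unit_stream:
  "finite I \<Longrightarrow> (\<Sum>q\<in>I. c q *\<^sub>R unit_stream q) k l = (if (k, l) \<in> I then c (k, l) else 0)"
  by (induction I rule: finite_induct) (auto simp: scaleR_fun_def unit_stream_def)

lemma inj_unit_stream: "inj unit_stream"
  by (rule injI) (metis unit_stream_def prod.exhaust_sel zero_neq_one)

lemma basis_of_stream_functions:
  defines "I \<equiv> {(i, j). interior_square i j}"
  shows "independent (unit_stream ` I)" "span (unit_stream ` I) = stream_functions"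
proof -
  have I: "finite I"
    unfolding I_def by (rule finite_interior_squares)
  show "independent (unit_stream ` I)"
  proof (rule independent_if_scalars_zero)
    fix f x assume 0: "(\<Sum>x\<in>unit_stream ` I. f x *\<^sub>R x) = 0" and "x \<in> unit_stream ` I"
    then obtain k l where kl: "(k, l) \<in> I" "x = unit_stream (k, l)" by auto
    have "(\<Sum>q\<in>I. f (unit_stream q) *\<^sub>R unit_stream q) = 0"
      using 0 by (simp add: sum.reindex inj_on_subset[OF inj_unit_stream])
    then have "(\<Sum>q\<in>I. f (unit_stream q) *\<^sub>R unit_stream q) k l = 0"
      by simp
    then show "f x = 0"
      unfolding sum_unit_stream[OF I] using kl by simp
  qed (use I in simp)
  show "span (unit_stream ` I) = stream_functions"
  proof
    have "unit_stream ` I \<subseteq> stream_functions"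
      by (auto simp: stream_functions_def unit_stream_def I_def)
    then show "span (unit_stream ` I) \<subseteq> stream_functions"
      using subspace_stream_functions by (rule span_minimal)
    show "stream_functions \<subseteq> span (unit_stream ` I)"
    proof
      fix \<psi> assume "\<psi> \<in> stream_functions"
      then have "\<psi> = (\<Sum>q\<in>I. \<psi> (fst q) (snd q) *\<^sub>R unit_stream q)"
        by (intro ext) (simp add: sum_unit_stream[OF I], simp add: stream_functions_def I_def)
      also have "\<dots> \<in> span (unit_stream ` I)"
        by (intro span_sum span_scale span_base) simp
      finally show "\<psi> \<in> span (unit_stream ` I)" .
    qed
  qed
qed

theorem dimension_V_h:
  assumes "connected (- domain)"
  shows "has_dimension (V_h domain mesh) (card (interior_squares domain mesh))"
proof -
  define I where "I = {(i, j). interior_square i j}"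
  define B where "B = curl_field ` unit_stream ` I"
  note basis = basis_of_stream_functions[folded I_def]
  have V: "V_h domain mesh = span B"
    unfolding B_def V_h_eq_curl_fields[OF assms] basis(2)[symmetric]
    by (rule linear_span_image[OF linear_curl_field, symmetric])
  have "inj_on curl_field (span (unit_stream ` I))"
    unfolding basis(2) by (rule inj_on_curl_field)
  then have ind: "independent B"
    unfolding B_def using basis(1) by (intro linear_independent_injective_image[OF linear_curl_field])
  have "inj_on curl_field (unit_stream ` I)"
    using inj_on_curl_field span_superset[of "unit_stream ` I"] unfolding basis(2) by (rule inj_on_subset)
  then have "card B = card I"
    unfolding B_def by (simp add: card_image inj_on_subset[OF inj_unit_stream])
  then have "dim (V_h domain mesh) = card (interior_squares domain mesh)"
    unfolding V card_interior_squares I_def[symmetric] using ind by (simp add: dim_eq_card_independent)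
  moreover have "finite B"
    unfolding B_def I_def using finite_interior_squares by simp
  ultimately show ?thesis
    unfolding has_dimension_def V using subspace_span by blast
qed

end

theorem theorem3p4:
  fixes \<Omega> :: "(real \<times> real) set" and T :: "(real \<times> real) set set" and h :: real
  assumes "polygonal_domain \<Omega>" and "simply_connected \<Omega>"
    and "uniform_square_mesh h \<Omega> T"
    and "standing_mesh_assumption \<Omega> T"
  shows "has_dimension (V_h \<Omega> T) (card (interior_squares \<Omega> T))"
proof -
  have \<Omega>: "\<Omega> \<noteq> {}" "open \<Omega>" "connected \<Omega>" "bounded \<Omega>" "interior (closure \<Omega>) = \<Omega>"
    using assms(1) by (auto simp: polygonal_domain_def)
  obtain z S where S: "finite S" "T = (\<lambda>(i, j). lattice_square h z i j) ` S"
    using mesh_on_lattice[OF assms(3) \<Omega>(3,1)] by blast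
  interpret square_lattice h z S
    using assms(3) S(1) by unfold_locales (auto simp: uniform_square_mesh_def)
  have T: "T = mesh"
    unfolding S(2) mesh_def ..
  have "\<Omega> = domain"
    using assms(3) \<Omega>(5) unfolding domain_def T uniform_square_mesh_def by auto
  moreover have "connected (- \<Omega>)"
    using \<Omega>(2,4) assms(2) by (rule connected_complement_of_simply_connected)
  ultimately show ?thesis
    using dimension_V_h T by simp
qed

end
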